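(* There is a $\mathbb{Q}(\mathbf{t})$-algebra isomorphism $\Psi:\mathbf{f}[\mathbf{t}]\rightarrow(\mathbf{f}[\mathbf{t}],* )$ satisfying $$\Psi(\theta_i)=\theta_i\ (i\in I),\quad \Psi(v)=\mathbf{t}^{-1}v,\quad \Psi(\pi)=-\pi,\quad \Psi(xy)=\Psi(x)*\Psi(y).$$
   Context: Datum. $(I,\cdot)$ is a bar-consistent super Cartan datum of anisotropic type: $I$ is a finite set with a $\mathbb{Z}$-valued symmetric bilinear form $\cdot$ on the free abelian group $\mathbb{Z}[I]$ such that $d_i=\frac{i\cdot i}{2}\in\mathbb{Z}_{>0}$ for all $i\in I$ and $a_{ij}=2\frac{i\cdot j}{i\cdot i}\in\mathbb{Z}_{\le 0}$ for $i\ne j$ (for $i=j$ the same formula gives $a_{ii}=2$); there is a partition $I=I_{\bar 0}\sqcup I_{\bar 1}$ with $I_{\bar1}\neq\emptyset$, with parity $p(i)=0$ for $i\in I_{\bar 0}$ and $p(i)=1$ for $i\in I_{\bar 1}$; $a_{ij}\in 2\mathbb{Z}$ for $i\in I_{\bar 1}$, $j\in I$; and $d_i\equiv p(i)\bmod 2$ for all $i$. Put $b_{ij}=1-a_{ij}$. Extend $p$ to a homomorphism $\mathbb{Z}[I]\to\mathbb{Z}_2$. Fix a total order $<$ on $I$. Scalars. $v$ is a formal parameter, $\pi$ an indeterminate with $\pi^2=1$; for a ring $R$, $R^\pi=R[\pi]/(\pi^2-1)$. $\mathbf{t}$ is a square root of $-1$, and $\mathbb{Q}(v,\mathbf{t})^\pi=\mathbb{Q}(v,\mathbf{t})[\pi]/(\pi^2-1)$.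 Put $v_i=v^{d_i}$, $\pi_i=\pi^{d_i}$. For $n\in\mathbb{Z}$, $k\in\mathbb{Z}_{\geq 0}$, $$\begin{bmatrix}n\\k\end{bmatrix}_{v,\pi}=\frac{\prod_{l=n-k+1}^n((\pi v)^l-v^{-l})}{\prod_{l=1}^k((\pi v)^l-v^{-l})}.$$ Half covering quantum group. $\mathbf{f}$ is the $\mathbb{Q}(v)^\pi$-algebra with generators $\theta_i$ ($i\in I$) and relations, for all $i\neq j$ in $I$, $$\sum_{k=0}^{b_{ij}}(-1)^k\pi^{\binom{k}{2}p(i)+kp(i)p(j)}\begin{bmatrix}b_{ij}\\k\end{bmatrix}_{v_i,\pi_i}\theta_i^{b_{ij}-k}\theta_j\theta_i^k=0.$$ It is $\mathbb{Z}[I]$-graded by $|\theta_i|=i$. Set $\mathbf{f}[\mathbf{t}]=\mathbb{Q}(v,\mathbf{t})^\pi\otimes_{\mathbb{Q}(v)^\pi}\mathbf{f}$. Twisted product. Let $\phi:\mathbb{Z}[I]\times\mathbb{Z}[I]\to\mathbb{Z}$ be the bilinear form with, for $i,j\in I$, $\phi(i,j)=d_ia_{ij}$ if $j<i$, $\phi(i,i)=d_i$, and $\phi(i,j)=-2p(i)p(j)$ if $j>i$ (with $p(i),p(j)\in\{0,1\}\subset\mathbb{Z}$). $(\mathbf{f}[\mathbf{t}],* )$ is the $\mathbb{Q}(v,\mathbf{t})^\pi$-module $\mathbf{f}[\mathbf{t}]$ with the associative product determined bilinearly by $x*y=\mathbf{t}^{\phi(|x|,|y|)}xy$ for homogeneous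 $x,y$. The conditions $\Psi(v)=\mathbf{t}^{-1}v$, $\Psi(\pi)=-\pi$ mean that $\Psi$ is semilinear with respect to the $\mathbb{Q}(\mathbf{t})$-algebra automorphism $v\mapsto\mathbf{t}^{-1}v$, $\pi\mapsto-\pi$ of $\mathbb{Q}(v,\mathbf{t})^\pi$. *)

theory Defs
  imports
    Complex_Main
    "HOL-Library.Poly_Mapping"
    "HOL-Computational_Algebra.Polynomial"
    "HOL-Computational_Algebra.Fraction_Field"
    "HOL-Algebra.QuotRing"
    "HOL-Algebra.Module"
    "HOL-Algebra.Free_Abelian_Groups"
    "HOL-Algebra.Algebraic_Closure_Type"
begin

text \<open>The field \<open>\<rat>(t)\<close>, \<open>t\<^sup>2 = -1\<close>, realised as \<open>\<rat>(\<i>) \<subseteq> \<complex>\<close>.\<close>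

typedef gauss_rat = "{z :: complex. Re z \<in> \<rat> \<and> Im z \<in> \<rat>}"
  by (rule exI[of _ 0]) simp

setup_lifting type_definition_gauss_rat

instantiation gauss_rat :: field
begin

lift_definition zero_gauss_rat :: gauss_rat is 0 by simp
lift_definition one_gauss_rat :: gauss_rat is 1 by simp
lift_definition plus_gauss_rat :: "gauss_rat \<Rightarrow> gauss_rat \<Rightarrow> gauss_rat" is "(+)" by simp
lift_definition minus_gauss_rat :: "gauss_rat \<Rightarrow> gauss_rat \<Rightarrow> gauss_rat" is "(-)" by simp
lift_definition uminus_gauss_rat :: "gauss_rat \<Rightarrow> gauss_rat" is uminus by simp
lift_definition times_gauss_rat :: "gauss_rat \<Rightarrow> gauss_rat \<Rightarrow> gauss_rat" is "(*)" by simp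
lift_definition inverse_gauss_rat :: "gauss_rat \<Rightarrow> gauss_rat" is inverse
  by (simp add: power2_eq_square)
lift_definition divide_gauss_rat :: "gauss_rat \<Rightarrow> gauss_rat \<Rightarrow> gauss_rat" is "(/)"
  by (simp add: Re_divide Im_divide power2_eq_square)

instance
  by standard (transfer; simp add: algebra_simps divide_inverse)+

end

lemma Rep_gauss_rat_of_nat: "Rep_gauss_rat (of_nat n) = of_nat n"
  by (induction n) (simp_all add: zero_gauss_rat.rep_eq one_gauss_rat.rep_eq plus_gauss_rat.rep_eq)

instance gauss_rat :: field_char_0
proof
  show "inj (of_nat :: nat \<Rightarrow> gauss_rat)"
    by (rule injI) (metis Rep_gauss_rat_of_nat of_nat_eq_iff)
qed

lift_definition gauss_t :: gauss_rat is \<i> by simp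

lemma gauss_t_squared: "gauss_t * gauss_t = -1"
  by transfer simp

text \<open>\<open>Cov a b\<close> is the class of \<open>a + b\<pi>\<close> in \<open>R\<^sup>\<pi> = R[\<pi>]/(\<pi>\<^sup>2 - 1)\<close>.\<close>

datatype 'a cov = Cov (cov_fst: 'a) (cov_snd: 'a)

instantiation cov :: (comm_ring_1) comm_ring_1
begin

definition zero_cov :: "'a cov" where "0 = Cov 0 0"
definition one_cov :: "'a cov" where "1 = Cov 1 0"
definition plus_cov :: "'a cov \<Rightarrow> 'a cov \<Rightarrow> 'a cov" where
  "x + y = Cov (cov_fst x + cov_fst y) (cov_snd x + cov_snd y)"
definition minus_cov :: "'a cov \<Rightarrow> 'a cov \<Rightarrow> 'a cov" where
  "x - y = Cov (cov_fst x - cov_fst y) (cov_snd x - cov_snd y)"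
definition uminus_cov :: "'a cov \<Rightarrow> 'a cov" where
  "- x = Cov (- cov_fst x) (- cov_snd x)"
definition times_cov :: "'a cov \<Rightarrow> 'a cov \<Rightarrow> 'a cov" where
  "x * y = Cov (cov_fst x * cov_fst y + cov_snd x * cov_snd y)
               (cov_fst x * cov_snd y + cov_snd x * cov_fst y)"

instance
  by standard
    (simp_all add: zero_cov_def one_cov_def plus_cov_def minus_cov_def uminus_cov_def
      times_cov_def cov.expand algebra_simps)

end

text \<open>Division in \<open>R\<^sup>\<pi>\<close> is multiplication by the inverse; it is meaningful only for
  denominators that are units, which is the only way it is used (\<open>R\<^sup>\<pi>\<close> has zero divisors).\<close>

instantiation cov :: (comm_ring_1) inverse
begin

definition inverse_cov :: "'a cov \<Rightarrow> 'a cov" where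
  "inverse_cov x = (if x dvd 1 then THE y. x * y = 1 else 0)"
definition divide_cov :: "'a cov \<Rightarrow> 'a cov \<Rightarrow> 'a cov" where
  "divide_cov x y = x * inverse y"

instance ..

end

definition cov_pi :: "'a::comm_ring_1 cov" where
  "cov_pi = Cov 0 1"

lemma cov_pi_squared: "cov_pi * cov_pi = 1"
  by (simp add: cov_pi_def times_cov_def one_cov_def)

definition cov_v :: "'k::field poly fract cov" where
  "cov_v = Cov (Fract [:0, 1:] 1) 0"

definition cov_const :: "'k::field \<Rightarrow> 'k poly fract cov" where
  "cov_const c = Cov (Fract [:c:] 1) 0"

type_synonym Qv_pi = "rat poly fract cov"
type_synonym Qvt_pi = "gauss_rat poly fract cov"

abbreviation cov_t :: Qvt_pi where
  "cov_t \<equiv> cov_const gauss_t"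

lemma map_poly_of_rat_mult:
  "map_poly (of_rat :: rat \<Rightarrow> 'k::field_char_0) (p * q) = map_poly of_rat p * map_poly of_rat q"
  by (rule poly_eqI) (simp add: coeff_map_poly coeff_mult of_rat_sum of_rat_mult)

lemma map_poly_of_rat_eq_0_iff:
  "map_poly (of_rat :: rat \<Rightarrow> 'k::field_char_0) p = 0 \<longleftrightarrow> p = 0"
  by (simp add: poly_eq_iff coeff_map_poly)

text \<open>The inclusion \<open>\<rat>(v) \<subseteq> \<rat>(v,t)\<close>, and its extension to the rings with \<open>\<pi>\<close> adjoined.\<close>

definition ratfun_incl :: "rat poly fract \<Rightarrow> gauss_rat poly fract" where
  "ratfun_incl x = (THE y. \<exists>p q. q \<noteq> 0 \<and> x = Fract p q \<and>
                      y = Fract (map_poly of_rat p) (map_poly of_rat q))"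

lemma ratfun_incl_Fract:
  assumes "q \<noteq> 0"
  shows "ratfun_incl (Fract p q) = Fract (map_poly of_rat p) (map_poly of_rat q)"
  unfolding ratfun_incl_def
proof (rule the_equality)
  fix y
  assume "\<exists>p' q'. q' \<noteq> 0 \<and> Fract p q = Fract p' q' \<and>
            y = Fract (map_poly of_rat p') (map_poly of_rat q')"
  then show "y = Fract (map_poly of_rat p) (map_poly of_rat q)"
    using assms
    by (auto simp: eq_fract map_poly_of_rat_eq_0_iff simp flip: map_poly_of_rat_mult)
qed (use assms in auto)

abbreviation scalar_incl :: "Qv_pi \<Rightarrow> Qvt_pi" where
  "scalar_incl \<equiv> map_cov ratfun_incl"

definition qbinom :: "'r \<Rightarrow> 'r \<Rightarrow> int \<Rightarrow> nat \<Rightarrow> 'r :: {comm_ring_1, inverse}" where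
  "qbinom v \<pi> n k =
     (\<Prod>l = n - int k + 1..n. (\<pi> * v) powi l - v powi (- l)) /
     (\<Prod>l = 1..int k. (\<pi> * v) powi l - v powi (- l))"

text \<open>The index set \<open>I\<close> is the whole (finite) type \<open>'i\<close>, and the bilinear form on \<open>\<int>[I]\<close> is
  given by its values \<open>dot i j\<close> on the basis \<open>I\<close>. The partition is given by the set \<open>I1\<close> of odd
  indices, with complement the set of even ones.\<close>

definition cd_d :: "('i \<Rightarrow> 'i \<Rightarrow> int) \<Rightarrow> 'i \<Rightarrow> int" where
  "cd_d dot i = dot i i div 2"

definition cd_a :: "('i \<Rightarrow> 'i \<Rightarrow> int) \<Rightarrow> 'i \<Rightarrow> 'i \<Rightarrow> int" where
  "cd_a dot i j = 2 * dot i j div dot i i"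

definition cd_p :: "'i set \<Rightarrow> 'i \<Rightarrow> nat" where
  "cd_p I1 i = (if i \<in> I1 then 1 else 0)"

locale super_cartan_datum =
  fixes dot :: "'i::finite \<Rightarrow> 'i \<Rightarrow> int" and I1 :: "'i set"
  assumes dot_sym: "dot i j = dot j i"
    and d_integral: "2 dvd dot i i"
    and d_pos: "cd_d dot i > 0"
    and a_integral: "i \<noteq> j \<Longrightarrow> dot i i dvd 2 * dot i j"
    and a_nonpos: "i \<noteq> j \<Longrightarrow> cd_a dot i j \<le> 0"
    and odd_nonempty: "I1 \<noteq> {}"
    and anisotropic_even: "i \<in> I1 \<Longrightarrow> even (cd_a dot i j)"
    and bar_consistent: "cd_d dot i mod 2 = int (cd_p I1 i)"

text \<open>Words in \<open>I\<close>, written additively (\<open>+\<close> is concatenation), so that \<open>'i fword \<Rightarrow>\<^sub>0 'r\<close> with its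
  convolution product is the free associative \<open>'r\<close>-algebra on \<open>I\<close>.\<close>

datatype 'i fword = FWord (letters: "'i list")

instantiation fword :: (type) monoid_add
begin

definition zero_fword :: "'a fword" where "0 = FWord []"
definition plus_fword :: "'a fword \<Rightarrow> 'a fword \<Rightarrow> 'a fword" where
  "u + w = FWord (letters u @ letters w)"

instance
  by standard (simp_all add: zero_fword_def plus_fword_def)

end

type_synonym 'i free_alg = "'i fword \<Rightarrow>\<^sub>0 Qv_pi"

definition free_scalar :: "Qv_pi \<Rightarrow> 'i free_alg" where
  "free_scalar c = Poly_Mapping.single 0 c"

definition free_gen :: "'i \<Rightarrow> 'i free_alg" where
  "free_gen i = Poly_Mapping.single (FWord [i]) 1"

definition serre :: "('i \<Rightarrow> 'i \<Rightarrow> int) \<Rightarrow> 'i set \<Rightarrow> 'i \<Rightarrow> 'i \<Rightarrow> 'i free_alg" where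
  "serre dot I1 i j =
    (let b = nat (1 - cd_a dot i j); p = cd_p I1; d = cd_d dot i in
      \<Sum>k\<le>b. free_scalar ((-1) ^ k * cov_pi ^ ((k choose 2) * p i + k * p i * p j)
                  * qbinom (cov_v powi d) (cov_pi powi d) (int b) k)
              * free_gen i ^ (b - k) * free_gen j * free_gen i ^ k)"

abbreviation free_ring :: "'i free_alg ring" where
  "free_ring \<equiv> ring_of_type_algebra"

definition serre_ideal :: "('i \<Rightarrow> 'i \<Rightarrow> int) \<Rightarrow> 'i set \<Rightarrow> 'i free_alg set" where
  "serre_ideal dot I1 = genideal free_ring {serre dot I1 i j | i j. i \<noteq> j}"

definition half_class :: "('i \<Rightarrow> 'i \<Rightarrow> int) \<Rightarrow> 'i set \<Rightarrow> 'i free_alg \<Rightarrow> 'i free_alg set" where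
  "half_class dot I1 x = serre_ideal dot I1 +>\<^bsub>free_ring\<^esub> x"

definition half_cqg :: "('i \<Rightarrow> 'i \<Rightarrow> int) \<Rightarrow> 'i set \<Rightarrow> (Qv_pi, 'i free_alg set) module" where
  "half_cqg dot I1 =
    (let Q = free_ring Quot serre_ideal dot I1 in
     ring.extend Q (module.fields (\<lambda>c K. half_class dot I1 (free_scalar c) \<otimes>\<^bsub>Q\<^esub> K)))"

definition weight :: "'i fword \<Rightarrow> 'i \<Rightarrow> int" where
  "weight w i = int (count_list (letters w) i)"

definition half_graded :: "('i \<Rightarrow> 'i \<Rightarrow> int) \<Rightarrow> 'i set \<Rightarrow> ('i \<Rightarrow> int) \<Rightarrow> 'i free_alg set set" where
  "half_graded dot I1 \<nu> =
    {half_class dot I1 x | x. \<forall>w \<in> Poly_Mapping.keys x. weight w = \<nu>}"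

text \<open>For a homomorphism \<open>h : A \<rightarrow> B\<close> of commutative rings and an \<open>A\<close>-algebra \<open>M\<close>, the
  \<open>B\<close>-algebra \<open>B \<otimes>\<^sub>A M\<close> is the free abelian group on \<open>B \<times> M\<close> modulo the subgroup generated by the
  usual relations. The product and the scalar multiplication of cosets are computed on
  representatives, as in \<^const>\<open>rcoset_mult\<close>.\<close>

definition tensor_free :: "('a, 'm) module \<Rightarrow> ('b \<times> 'm \<Rightarrow>\<^sub>0 int) monoid" where
  "tensor_free M = free_Abelian_group (UNIV \<times> carrier M)"

definition tensor_rels ::
    "('a::comm_ring_1 \<Rightarrow> 'b::comm_ring_1) \<Rightarrow> ('a, 'm) module \<Rightarrow> ('b \<times> 'm \<Rightarrow>\<^sub>0 int) set" where
  "tensor_rels h M = generate (tensor_free M)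
    ({frag_of (b + b', x) - frag_of (b, x) - frag_of (b', x) | b b' x. x \<in> carrier M} \<union>
     {frag_of (b, x \<oplus>\<^bsub>M\<^esub> y) - frag_of (b, x) - frag_of (b, y) | b x y.
        x \<in> carrier M \<and> y \<in> carrier M} \<union>
     {frag_of (b * h a, x) - frag_of (b, a \<odot>\<^bsub>M\<^esub> x) | a b x. x \<in> carrier M})"

definition tensor_class ::
    "('a::comm_ring_1 \<Rightarrow> 'b::comm_ring_1) \<Rightarrow> ('a, 'm) module \<Rightarrow>
     ('b \<times> 'm \<Rightarrow>\<^sub>0 int) \<Rightarrow> ('b \<times> 'm \<Rightarrow>\<^sub>0 int) set" where
  "tensor_class h M u = tensor_rels h M #>\<^bsub>tensor_free M\<^esub> u"

definition pure_tensor ::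
    "('a::comm_ring_1 \<Rightarrow> 'b::comm_ring_1) \<Rightarrow> ('a, 'm) module \<Rightarrow>
     'b \<Rightarrow> 'm \<Rightarrow> ('b \<times> 'm \<Rightarrow>\<^sub>0 int) set" where
  "pure_tensor h M b x = tensor_class h M (frag_of (b, x))"

definition base_change ::
    "('a::comm_ring_1 \<Rightarrow> 'b::comm_ring_1) \<Rightarrow> ('a, 'm) module \<Rightarrow>
     ('b, ('b \<times> 'm \<Rightarrow>\<^sub>0 int) set) module" where
  "base_change h M =
    (let T = tensor_free M Mod tensor_rels h M in
     \<lparr> carrier = carrier T,
       monoid.mult = (\<lambda>K L. \<Union>u\<in>K. \<Union>w\<in>L. tensor_class h M
         (frag_extend (\<lambda>(b, x). frag_extend (\<lambda>(c, y). frag_of (b * c, x \<otimes>\<^bsub>M\<^esub> y)) w) u)),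
       one = pure_tensor h M 1 \<one>\<^bsub>M\<^esub>,
       ring.zero = \<one>\<^bsub>T\<^esub>,
       ring.add = (\<lambda>K L. K \<otimes>\<^bsub>T\<^esub> L),
       module.smult = (\<lambda>c K. \<Union>u\<in>K. tensor_class h M
         (frag_extend (\<lambda>(b, x). frag_of (c * b, x)) u)) \<rparr>)"

type_synonym 'i half_t = "(Qvt_pi \<times> 'i free_alg set \<Rightarrow>\<^sub>0 int) set"

definition half_cqg_t :: "('i \<Rightarrow> 'i \<Rightarrow> int) \<Rightarrow> 'i set \<Rightarrow> (Qvt_pi, 'i half_t) module" where
  "half_cqg_t dot I1 = base_change scalar_incl (half_cqg dot I1)"

definition theta :: "('i \<Rightarrow> 'i \<Rightarrow> int) \<Rightarrow> 'i set \<Rightarrow> 'i \<Rightarrow> 'i half_t" where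
  "theta dot I1 i =
    pure_tensor scalar_incl (half_cqg dot I1) 1 (half_class dot I1 (free_gen i))"

text \<open>The homogeneous component of degree \<open>\<nu>\<close> is \<open>\<rat>(v,t)\<^sup>\<pi> \<otimes> f\<^sub>\<nu>\<close>.\<close>

definition half_t_graded ::
    "('i \<Rightarrow> 'i \<Rightarrow> int) \<Rightarrow> 'i set \<Rightarrow> ('i \<Rightarrow> int) \<Rightarrow> 'i half_t set" where
  "half_t_graded dot I1 \<nu> = generate (add_monoid (half_cqg_t dot I1))
    {pure_tensor scalar_incl (half_cqg dot I1) c x | c x. x \<in> half_graded dot I1 \<nu>}"

definition phi_basis ::
    "('i::linorder \<Rightarrow> 'i \<Rightarrow> int) \<Rightarrow> 'i set \<Rightarrow> 'i \<Rightarrow> 'i \<Rightarrow> int" where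
  "phi_basis dot I1 i j =
    (if j < i then cd_d dot i * cd_a dot i j
     else if j = i then cd_d dot i
     else - 2 * int (cd_p I1 i) * int (cd_p I1 j))"

definition phi ::
    "('i::{finite,linorder} \<Rightarrow> 'i \<Rightarrow> int) \<Rightarrow> 'i set \<Rightarrow> ('i \<Rightarrow> int) \<Rightarrow> ('i \<Rightarrow> int) \<Rightarrow> int" where
  "phi dot I1 \<mu> \<nu> = (\<Sum>i\<in>UNIV. \<Sum>j\<in>UNIV. \<mu> i * \<nu> j * phi_basis dot I1 i j)"

definition is_twisted_product ::
    "('i::{finite,linorder} \<Rightarrow> 'i \<Rightarrow> int) \<Rightarrow> 'i set \<Rightarrow>
     ('i half_t \<Rightarrow> 'i half_t \<Rightarrow> 'i half_t) \<Rightarrow> bool" where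
  "is_twisted_product dot I1 m \<longleftrightarrow>
    (let F = half_cqg_t dot I1 in
      (\<forall>x\<in>carrier F. \<forall>y\<in>carrier F. m x y \<in> carrier F) \<and>
      (\<forall>x\<in>carrier F. \<forall>y\<in>carrier F. \<forall>z\<in>carrier F.
         m (x \<oplus>\<^bsub>F\<^esub> y) z = m x z \<oplus>\<^bsub>F\<^esub> m y z \<and> m z (x \<oplus>\<^bsub>F\<^esub> y) = m z x \<oplus>\<^bsub>F\<^esub> m z y) \<and>
      (\<forall>c. \<forall>x\<in>carrier F. \<forall>y\<in>carrier F.
         m (c \<odot>\<^bsub>F\<^esub> x) y = c \<odot>\<^bsub>F\<^esub> m x y \<and> m x (c \<odot>\<^bsub>F\<^esub> y) = c \<odot>\<^bsub>F\<^esub> m x y) \<and>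
      (\<forall>\<mu> \<nu>. \<forall>x\<in>half_t_graded dot I1 \<mu>. \<forall>y\<in>half_t_graded dot I1 \<nu>.
         m x y = cov_t powi phi dot I1 \<mu> \<nu> \<odot>\<^bsub>F\<^esub> (x \<otimes>\<^bsub>F\<^esub> y)) \<and>
      (\<forall>x y. x \<notin> carrier F \<or> y \<notin> carrier F \<longrightarrow> m x y = undefined))"

text \<open>The last clause of \<^const>\<open>is_twisted_product\<close> makes \<open>m\<close> unique as a total function.\<close>

definition twisted_product ::
    "('i::{finite,linorder} \<Rightarrow> 'i \<Rightarrow> int) \<Rightarrow> 'i set \<Rightarrow> 'i half_t \<Rightarrow> 'i half_t \<Rightarrow> 'i half_t" where
  "twisted_product dot I1 = (THE m. is_twisted_product dot I1 m)"

definition half_cqg_t_twisted ::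
    "('i::{finite,linorder} \<Rightarrow> 'i \<Rightarrow> int) \<Rightarrow> 'i set \<Rightarrow> (Qvt_pi, 'i half_t) module" where
  "half_cqg_t_twisted dot I1 = (half_cqg_t dot I1)\<lparr>monoid.mult := twisted_product dot I1\<rparr>"

end

theory Submission
  imports Defs
begin

text \<open>Write \<open>A\<close> for the free algebra over \<open>\<rat>(v,t)\<^sup>\<pi>\<close> on the letters \<open>I\<close>, and \<open>\<sigma>\<close> for the automorphism
\<open>v \<mapsto> t\<^sup>-\<^sup>1 v\<close>, \<open>\<pi> \<mapsto> -\<pi>\<close> of the scalars. The conditions on \<open>\<Psi>\<close> leave no choice on words: a word
\<open>i\<^sub>1 \<dots> i\<^sub>n\<close> with coefficient \<open>c\<close> must go to \<open>\<sigma>(c) t\<^sup>e i\<^sub>1 \<dots> i\<^sub>n\<close>, where \<open>e\<close> is the sum of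
\<open>\<phi>(i\<^sub>a, i\<^sub>b)\<close> over all pairs of positions \<open>a < b\<close>. This formula defines a \<open>\<sigma>\<close>-semilinear bijection \<open>twist\<close>
of \<open>A\<close>, and since the exponent of a concatenation \<open>uw\<close> exceeds the sum of the exponents of \<open>u\<close> and \<open>w\<close>
by exactly \<open>\<phi>(|u|,|w|)\<close>, it is multiplicative up to the twisting factor (\<open>twist_mult\<close>).

What has to be shown is that \<open>twist\<close> and its inverse preserve the ideal of Serre relations. Because
\<open>\<sigma>((\<pi>v)\<^sup>l - v\<^sup>-\<^sup>l) = t\<^sup>l((\<pi>v)\<^sup>l - v\<^sup>-\<^sup>l)\<close>, the automorphism multiplies the \<open>k\<close>-th binomial coefficient of
the relation for \<open>(i,j)\<close> by \<open>t\<close> to the power \<open>d\<^sub>i k(b - k)\<close>, with \<open>b = 1 - a\<^sub>i\<^sub>j\<close>; it contributes a sign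
through \<open>\<pi> \<mapsto> -\<pi>\<close>, and the word \<open>i\<^sup>b\<^sup>-\<^sup>k j i\<^sup>k\<close> contributes its own power of \<open>t\<close>. Up to multiples
of \<open>4\<close> the total exponent is independent of \<open>k\<close> (\<open>serre_exponent\<close>): for even \<open>i\<close> because \<open>d\<^sub>i\<close> is even,
for odd \<open>i\<close> because \<open>a\<^sub>i\<^sub>j\<close> is even and \<open>d\<^sub>i\<close> is odd. So a Serre element is only multiplied by a power
of \<open>t\<close> (\<open>twist_serre\<close>).

The algebra \<open>f[t]\<close> is given as a tensor product over \<open>\<rat>(v)\<^sup>\<pi>\<close> of a quotient of a smaller free algebra.
To use the argument above it is identified with the quotient of \<open>A\<close> by the Serre relations; this
rests on \<open>tensor_rels_iff\<close>, which says that a formal sum of pairs \<open>(b, x)\<close> is a tensor relation exactly if its value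
\<open>\<Sum> b x\<close> in \<open>A\<close> lies in the Serre ideal.

Finally, the twisted product is obtained by transport of structure: \<open>\<Psi>(\<Psi>\<^sup>-\<^sup>1 x \<cdot> \<Psi>\<^sup>-\<^sup>1 y)\<close> is bilinear, and
it equals \<open>t\<^sup>\<phi> x y\<close> on homogeneous elements by the multiplicativity of \<open>twist\<close>. Homogeneous
elements span, so these properties determine it, and \<open>\<Psi>\<close> is an isomorphism for it by construction.\<close>

section \<open>Embeddings of the scalar rings\<close>

locale ring_embedding =
  fixes f :: "'a::comm_ring_1 \<Rightarrow> 'b::comm_ring_1"
  assumes add: "f (x + y) = f x + f y"
    and mult: "f (x * y) = f x * f y"
    and one: "f 1 = 1"
    and inj0: "f x = 0 \<Longrightarrow> x = 0"
begin

lemma zero: "f 0 = 0"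
  using add[of 0 0] by simp

lemma uminus: "f (- x) = - f x"
  using add[of x "- x"] by (simp add: zero eq_neg_iff_add_eq_0 add.commute)

lemma minus: "f (x - y) = f x - f y"
  using add[of x "- y"] by (simp add: uminus)

lemma power: "f (x ^ n) = f x ^ n"
  by (induction n) (simp_all add: one mult)

lemma prod: "f (prod g A) = (\<Prod>x\<in>A. f (g x))"
  by (induction A rule: infinite_finite_induct) (simp_all add: one mult)

lemma eq_0_iff: "f x = 0 \<longleftrightarrow> x = 0"
  using inj0 zero by blast

lemma injective: "f x = f y \<longleftrightarrow> x = y"
  using eq_0_iff[of "x - y"] by (simp add: minus)

end

text \<open>The map of fraction fields induced by \<open>f\<close>. For an injective ring homomorphism
denominators stay nonzero and the value does not depend on the representative.\<close>

definition fract_map :: "('a::idom \<Rightarrow> 'b::idom) \<Rightarrow> 'a fract \<Rightarrow> 'b fract" where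
  "fract_map f x = (THE y. \<exists>p q. q \<noteq> 0 \<and> x = Fract p q \<and> y = Fract (f p) (f q))"

context
  fixes f :: "'a::idom \<Rightarrow> 'b::idom"
  assumes f: "ring_embedding f"
begin

interpretation ring_embedding f by (rule f)

lemma fract_map_Fract:
  assumes "q \<noteq> 0"
  shows "fract_map f (Fract p q) = Fract (f p) (f q)"
  unfolding fract_map_def
proof (rule the_equality)
  fix y
  assume "\<exists>p' q'. q' \<noteq> 0 \<and> Fract p q = Fract p' q' \<and> y = Fract (f p') (f q')"
  then show "y = Fract (f p) (f q)"
    using assms by (auto simp: eq_fract eq_0_iff simp flip: mult)
qed (use assms in auto)

lemma ring_embedding_fract_map: "ring_embedding (fract_map f)"
proof
  fix x y :: "'a fract"
  show "fract_map f (x + y) = fract_map f x + fract_map f y"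
    by (cases x; cases y) (simp add: fract_map_Fract eq_0_iff add mult)
  show "fract_map f (x * y) = fract_map f x * fract_map f y"
    by (cases x; cases y) (simp add: fract_map_Fract eq_0_iff mult)
  show "fract_map f 1 = 1"
    by (simp add: One_fract_def fract_map_Fract one)
  show "fract_map f x = 0 \<Longrightarrow> x = 0"
    by (cases x) (simp add: fract_map_Fract Zero_fract_def eq_fract eq_0_iff)
qed

end

lemma fract_map_inverse:
  assumes "ring_embedding f" "ring_embedding g" "\<And>x. f (g x) = x"
  shows "fract_map f (fract_map g x) = x"
  by (cases x) (simp add: fract_map_Fract ring_embedding.eq_0_iff assms)

lemma ratfun_incl_eq: "ratfun_incl = fract_map (map_poly of_rat)"
  by (simp add: fun_eq_iff ratfun_incl_def fract_map_def)

lemma ring_embedding_ratfun_incl: "ring_embedding ratfun_incl"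
  unfolding ratfun_incl_eq
proof (rule ring_embedding_fract_map, unfold_locales)
  show "map_poly of_rat (p + q) = map_poly of_rat p + map_poly of_rat q" for p q
    by (rule poly_eqI) (simp add: coeff_map_poly of_rat_add)
qed (simp_all add: map_poly_of_rat_mult map_poly_of_rat_eq_0_iff)

text \<open>The substitution \<open>v \<mapsto> a v\<close> in rational functions.\<close>

definition v_scale :: "'k::field \<Rightarrow> 'k poly fract \<Rightarrow> 'k poly fract" where
  "v_scale a = fract_map (\<lambda>p. pcompose p [:0, a:])"

lemma pcompose_scale_inverse:
  fixes a :: "'k::field"
  assumes "a * b = 1"
  shows "pcompose (pcompose p [:0, a:]) [:0, b:] = p"
  using assms by (simp add: pcompose_assoc[symmetric] pcompose_pCons mult.commute)

lemma ring_embedding_pcompose_scale: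
  fixes a :: "'k::field"
  assumes "a \<noteq> 0"
  shows "ring_embedding (\<lambda>p. pcompose p [:0, a:])"
proof
  fix p :: "'k poly" assume "pcompose p [:0, a:] = 0"
  then show "p = 0"
    using pcompose_scale_inverse[of a "inverse a" p] assms by simp
qed (simp_all add: pcompose_add pcompose_mult pcompose_1)

lemma v_scale_Fract:
  assumes "a \<noteq> 0" "q \<noteq> 0"
  shows "v_scale a (Fract p q) = Fract (pcompose p [:0, a:]) (pcompose q [:0, a:])"
  unfolding v_scale_def using assms by (intro fract_map_Fract ring_embedding_pcompose_scale)

lemma ring_embedding_v_scale: "a \<noteq> 0 \<Longrightarrow> ring_embedding (v_scale a)"
  unfolding v_scale_def by (intro ring_embedding_fract_map ring_embedding_pcompose_scale)

lemma v_scale_inverse: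
  assumes "a * b = 1"
  shows "v_scale b (v_scale a x) = x"
proof -
  have "a \<noteq> 0" "b \<noteq> 0"
    using assms by auto
  then show ?thesis
    unfolding v_scale_def
    by (intro fract_map_inverse ring_embedding_pcompose_scale pcompose_scale_inverse assms)
qed

section \<open>Scalars with \<open>\<pi>\<close> adjoined\<close>

text \<open>Multiplying \<open>a + b\<pi>\<close> by its conjugate \<open>a - b\<pi>\<close> gives the norm \<open>a\<^sup>2 - b\<^sup>2\<close>, so the element is a unit
if and only if the norm is nonzero. For a non-unit both sides vanish, by \<open>x / 0 = 0\<close>. Having one formula for all
elements means that field homomorphisms can be pushed through quotients in \<open>R\<^sup>\<pi>\<close> with no
discussion of units.\<close>

lemma inverse_Cov:
  fixes a b :: "'k::field"
  shows "inverse (Cov a b) = Cov (a / (a\<^sup>2 - b\<^sup>2)) (- b / (a\<^sup>2 - b\<^sup>2))"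
proof (cases "a\<^sup>2 - b\<^sup>2 = 0")
  case True
  have "\<not> Cov a b dvd 1"
  proof
    assume "Cov a b dvd 1"
    then obtain c d where "Cov a b * Cov c d = 1"
      unfolding dvd_def by (metis cov.exhaust)
    then have 1: "a * c + b * d = 1" and 2: "a * d + b * c = 0"
      by (simp_all add: times_cov_def one_cov_def)
    \<comment> \<open>Specialising \<open>\<pi>\<close> to \<open>1\<close> and to \<open>-1\<close> gives two ring homomorphisms, one of which kills \<open>a + b\<pi>\<close>.\<close>
    have "a + b = 0 \<or> a - b = 0"
      using True by (simp add: power2_eq_square square_diff_square_factored)
    moreover have "(a + b) * (c + d) = (a * c + b * d) + (a * d + b * c)"
        "(a - b) * (c - d) = (a * c + b * d) - (a * d + b * c)"
      by (simp_all add: algebra_simps)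
    then have "(a + b) * (c + d) = 1" "(a - b) * (c - d) = 1"
      by (simp_all add: 1 2)
    ultimately show False by auto
  qed
  then show ?thesis using True
    by (simp add: inverse_cov_def zero_cov_def)
next
  case False
  have *: "Cov a b * Cov (a / (a\<^sup>2 - b\<^sup>2)) (- b / (a\<^sup>2 - b\<^sup>2)) = 1"
    using False by (simp add: times_cov_def one_cov_def power2_eq_square divide_simps)
  have "y = Cov (a / (a\<^sup>2 - b\<^sup>2)) (- b / (a\<^sup>2 - b\<^sup>2))" if "Cov a b * y = 1" for y
  proof -
    have "y = (Cov a b * Cov (a / (a\<^sup>2 - b\<^sup>2)) (- b / (a\<^sup>2 - b\<^sup>2))) * y"
      by (simp only: * mult_1)
    also have "\<dots> = Cov (a / (a\<^sup>2 - b\<^sup>2)) (- b / (a\<^sup>2 - b\<^sup>2)) * (Cov a b * y)"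
      by (simp only: mult_ac)
    finally show ?thesis by (simp only: that mult_1_right)
  qed
  then have "(THE y. Cov a b * y = 1) = Cov (a / (a\<^sup>2 - b\<^sup>2)) (- b / (a\<^sup>2 - b\<^sup>2))"
    using * by (rule the_equality[rotated])
  moreover have "Cov a b dvd 1"
    using * by (metis dvd_triv_left)
  ultimately show ?thesis
    by (simp add: inverse_cov_def)
qed

text \<open>The map \<open>a + b\<pi> \<mapsto> f(a) + f(b) e\<pi>\<close>; both the inclusion of scalars (\<open>e = 1\<close>) and the automorphism
\<open>\<sigma>\<close> (\<open>e = -1\<close>) have this form.\<close>

definition cov_map :: "('a::comm_ring_1 \<Rightarrow> 'b::comm_ring_1) \<Rightarrow> 'b \<Rightarrow> 'a cov \<Rightarrow> 'b cov" where
  "cov_map f e x = Cov (f (cov_fst x)) (e * f (cov_snd x))"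

lemma map_cov_eq_cov_map: "map_cov f = cov_map f 1"
  by (simp add: fun_eq_iff cov_map_def cov.expand cov.map_sel)

locale inverse_embedding = ring_embedding f
  for f :: "'a::{comm_ring_1, inverse} \<Rightarrow> 'b::{comm_ring_1, inverse}" +
  assumes inverse: "f (inverse x) = inverse (f x)"
    and divide: "f (x / y) = f x / f y"
begin

lemma power_int: "f (x powi n) = f x powi n"
  by (simp add: power_int_def power inverse)

lemma qbinom: "f (qbinom v \<pi> n k) = qbinom (f v) (f \<pi>) n k"
  by (simp add: qbinom_def divide prod minus power_int mult)

end

lemma inverse_embedding_cov_map:
  fixes f :: "'a::field \<Rightarrow> 'b::field"
  assumes f: "ring_embedding f" and e: "e * e = 1"
  shows "inverse_embedding (cov_map f e)"
proof -
  interpret ring_embedding f by (rule f)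
  have ee: "e * (e * x) = x" for x using e by (simp flip: mult.assoc)
  have e2: "e\<^sup>2 = 1" using e by (simp add: power2_eq_square)
  have e0: "e \<noteq> 0" using e by auto
  have inv: "f (inverse x) = inverse (f x)" for x
    by (cases "x = 0") (auto simp: zero one intro!: inverse_unique[symmetric] simp flip: mult)
  then have div: "f (x / y) = f x / f y" for x y
    by (simp add: divide_inverse mult)
  have m: "cov_map f e (x * y) = cov_map f e x * cov_map f e y" for x y
    by (simp add: cov_map_def times_cov_def add mult ee algebra_simps)
  have i: "cov_map f e (inverse x) = inverse (cov_map f e x)" for x
    by (cases x) (simp add: cov_map_def inverse_Cov div minus power uminus power_mult_distrib e2)
  show ?thesis
  proof
    fix x y :: "'a cov"
    show "cov_map f e (x + y) = cov_map f e x + cov_map f e y"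
      by (simp add: cov_map_def plus_cov_def add algebra_simps)
    show "cov_map f e 1 = 1"
      by (simp add: cov_map_def one_cov_def one zero)
    show "cov_map f e x = 0 \<Longrightarrow> x = 0"
      by (cases x) (simp add: cov_map_def zero_cov_def eq_0_iff e0)
    show "cov_map f e (x / y) = cov_map f e x / cov_map f e y"
      by (simp add: divide_cov_def m i)
  qed (rule m, rule i)
qed

lemma cov_const_1: "cov_const 1 = 1"
  by (simp add: cov_const_def one_cov_def One_fract_def pCons_one)

lemma cov_const_mult: "cov_const (a * b) = cov_const a * cov_const b"
  by (simp add: cov_const_def times_cov_def Zero_fract_def mult.commute)

lemma cov_const_uminus: "cov_const (- a) = - cov_const a"
  by (simp add: cov_const_def uminus_cov_def)

lemma cov_const_power: "cov_const (a ^ n) = cov_const a ^ n"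
  by (induction n) (simp_all add: cov_const_1 cov_const_mult)

lemma inverse_cov_const_mult:
  fixes x :: "'k::field poly fract cov"
  assumes "a \<noteq> 0"
  shows "inverse (cov_const a * x) = cov_const (inverse a) * inverse x"
proof (cases x)
  case (Cov p q)
  define c where "c = Fract [:a:] 1"
  have c: "c \<noteq> 0" "Fract [:inverse a:] 1 = inverse c"
    using assms by (simp_all add: c_def Zero_fract_def eq_fract)
  have "(c * p)\<^sup>2 - (c * q)\<^sup>2 = c * c * (p\<^sup>2 - q\<^sup>2)"
    by (simp add: power2_eq_square algebra_simps)
  with c show ?thesis
    by (simp add: Cov cov_const_def times_cov_def inverse_Cov divide_inverse flip: c_def)
qed

lemma inverse_cov_const:
  fixes a :: "'k::field"
  assumes "a \<noteq> 0"
  shows "inverse (cov_const a) = cov_const (inverse a)"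
proof -
  have "inverse (1 :: 'k poly fract cov) = 1"
    by (simp add: one_cov_def inverse_Cov)
  then show ?thesis
    using inverse_cov_const_mult[OF assms, of 1] by simp
qed

lemma power_int_cov_const_mult:
  assumes "a \<noteq> 0"
  shows "(cov_const a * x) powi n = cov_const (a powi n) * x powi n"
  using assms
  by (simp add: power_int_def inverse_cov_const_mult power_mult_distrib cov_const_power)

lemma power_int_cov_const: "a \<noteq> 0 \<Longrightarrow> cov_const a powi n = cov_const (a powi n)"
  by (simp add: power_int_def inverse_cov_const cov_const_power)

lemma cov_const_prod: "cov_const (prod g S) = (\<Prod>x\<in>S. cov_const (g x))"
  by (induction S rule: infinite_finite_induct) (simp_all add: cov_const_1 cov_const_mult)

lemma prod_power_int:
  fixes a :: "'k::field"
  assumes "a \<noteq> 0"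
  shows "(\<Prod>x\<in>S. a powi g x) = a powi (\<Sum>x\<in>S. g x)"
  by (induction S rule: infinite_finite_induct) (simp_all add: power_int_add assms)

lemma sum_interval_diff: "(\<Sum>l = n - int k + 1..n. l) - (\<Sum>l = 1..int k. l) = int k * (n - int k)"
proof (induction k)
  case (Suc k)
  have "{n - int (Suc k) + 1..n} = insert (n - int k) {n - int k + 1..n}"
       "{1..int (Suc k)} = insert (int k + 1) {1..int k}" by auto
  with Suc show ?case by (simp add: algebra_simps)
qed simp

text \<open>Under the substitution the factor \<open>(\<pi>v)\<^sup>l - v\<^sup>-\<^sup>l\<close> is multiplied by \<open>a\<^sup>l\<close>, so the whole binomial
coefficient is multiplied by \<open>a\<close> to the difference of the sums of the indices \<open>l\<close> in numerator and
denominator, which is \<open>k(n - k)\<close>.\<close>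

lemma qbinom_rescale:
  fixes v \<pi> v' \<pi>' :: "'k::field poly fract cov"
  assumes a: "a \<noteq> 0" and v': "v' = cov_const (inverse a) * v"
    and pv: "\<pi>' * v' = cov_const a * (\<pi> * v)"
  shows "qbinom v' \<pi>' n k = cov_const (a powi (int k * (n - int k))) * qbinom v \<pi> n k"
proof -
  define br where "br l = (\<pi> * v) powi l - v powi (- l)" for l
  have br: "(\<pi>' * v') powi l - v' powi (- l) = cov_const (a powi l) * br l" for l
  proof -
    have "(\<pi>' * v') powi l = cov_const (a powi l) * (\<pi> * v) powi l"
      unfolding pv using a by (rule power_int_cov_const_mult)
    moreover have "v' powi (- l) = cov_const (a powi l) * v powi (- l)"
      unfolding v' using a by (simp add: power_int_cov_const_mult power_int_minus power_int_inverse)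
    ultimately show ?thesis by (simp add: br_def right_diff_distrib)
  qed
  have P: "(\<Prod>l\<in>S. (\<pi>' * v') powi l - v' powi (- l)) = cov_const (a powi \<Sum>S) * (\<Prod>l\<in>S. br l)" for S
    using a by (simp add: br prod.distrib prod_power_int flip: cov_const_prod)
  have "qbinom v' \<pi>' n k = cov_const (a powi \<Sum>{n - int k + 1..n} * inverse (a powi \<Sum>{1..int k})) * qbinom v \<pi> n k"
    using a by (simp add: qbinom_def P divide_cov_def inverse_cov_const_mult cov_const_mult flip: br_def)
  also have "a powi \<Sum>{n - int k + 1..n} * inverse (a powi \<Sum>{1..int k}) = a powi (int k * (n - int k))"
    using a sum_interval_diff[where n=n and k=k] by (simp flip: power_int_minus power_int_add)
  finally show ?thesis .
qed

section \<open>Powers of \<open>t\<close> and the scalar automorphism\<close>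

definition tpow :: "int \<Rightarrow> Qvt_pi" where
  "tpow n = cov_const (gauss_t powi n)"

lemma gauss_t_nonzero: "gauss_t \<noteq> 0"
  using gauss_t_squared by auto

lemma tpow_0: "tpow 0 = 1"
  by (simp add: tpow_def cov_const_1)

lemma tpow_add: "tpow (m + n) = tpow m * tpow n"
  by (simp add: tpow_def power_int_add gauss_t_nonzero cov_const_mult)

lemma tpow_minus_cancel: "tpow n * (tpow (- n) * x) = x" "tpow (- n) * (tpow n * x) = x"
proof -
  have "tpow n * tpow (- n) = 1" "tpow (- n) * tpow n = 1"
    by (simp_all add: tpow_0 flip: tpow_add)
  then show "tpow n * (tpow (- n) * x) = x" "tpow (- n) * (tpow n * x) = x"
    by (simp_all flip: mult.assoc)
qed

lemma tpow_unit: "tpow (- n) * tpow n = 1"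
  using tpow_minus_cancel(2)[of n 1] by simp

text \<open>\<open>t\<^sup>2 = -1\<close>: signs are powers of \<open>t\<close>, which reduces the comparison of coefficients to a congruence
of exponents modulo \<open>4\<close>.\<close>

lemma tpow_double: "tpow (2 * n) = (-1) ^ nat \<bar>n\<bar>"
proof -
  have "gauss_t powi (2 * n) = (-1) powi n"
    by (simp add: power_int_mult power2_eq_square gauss_t_squared power_int_numeral)
  also have "\<dots> = (-1) ^ nat \<bar>n\<bar>"
    by (simp add: power_int_def)
  finally show ?thesis
    by (simp add: tpow_def cov_const_power cov_const_uminus cov_const_1)
qed

lemma tpow_add_4: "tpow (m + 4 * z) = tpow m"
  using tpow_double[of "2 * z"] by (simp add: tpow_add even_nat_iff)

lemma cov_t_power_int: "cov_t powi n = tpow n"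
  by (simp add: tpow_def power_int_cov_const gauss_t_nonzero)

text \<open>The automorphism \<open>\<sigma>\<close> of the scalars, \<open>v \<mapsto> t\<^sup>-\<^sup>1 v\<close> and \<open>\<pi> \<mapsto> -\<pi>\<close>.\<close>

definition sig :: "Qvt_pi \<Rightarrow> Qvt_pi" where
  "sig = cov_map (v_scale (inverse gauss_t)) (-1)"

definition sig_inv :: "Qvt_pi \<Rightarrow> Qvt_pi" where
  "sig_inv = cov_map (v_scale gauss_t) (-1)"

interpretation sig: inverse_embedding sig
  unfolding sig_def
  by (intro inverse_embedding_cov_map ring_embedding_v_scale) (simp_all add: gauss_t_nonzero)

interpretation sig_inv: inverse_embedding sig_inv
  unfolding sig_inv_def
  by (intro inverse_embedding_cov_map ring_embedding_v_scale) (simp_all add: gauss_t_nonzero)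

interpretation incl: inverse_embedding scalar_incl
  unfolding map_cov_eq_cov_map
  by (intro inverse_embedding_cov_map ring_embedding_ratfun_incl) simp

interpretation vs: ring_embedding "v_scale (inverse gauss_t)"
  by (rule ring_embedding_v_scale) (simp add: gauss_t_nonzero)

lemma sig_sig_inv: "sig (sig_inv x) = x"
  by (cases x) (simp add: sig_def sig_inv_def cov_map_def vs.uminus v_scale_inverse gauss_t_nonzero)

lemma sig_inv_sig: "sig_inv (sig x) = x"
  by (cases x) (simp add: sig_def sig_inv_def cov_map_def v_scale_inverse gauss_t_nonzero
      ring_embedding.uminus[OF ring_embedding_v_scale])

lemma sig_const: "sig (cov_const c) = cov_const c"
  by (simp add: sig_def cov_map_def cov_const_def vs.zero v_scale_Fract gauss_t_nonzero
      pcompose_pCons pcompose_1)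

lemma sig_v: "sig cov_v = cov_const (inverse gauss_t) * cov_v"
  by (simp add: sig_def cov_map_def cov_v_def cov_const_def vs.zero v_scale_Fract gauss_t_nonzero
      times_cov_def pcompose_pCons pcompose_1)

lemma sig_pi: "sig cov_pi = - cov_pi"
  by (simp add: sig_def cov_map_def cov_pi_def vs.zero vs.one uminus_cov_def)

text \<open>Here \<open>\<sigma>(v\<^sub>i) = a\<^sup>-\<^sup>1 v\<^sub>i\<close> with \<open>a = t\<close> to the power \<open>d\<close>, while \<open>\<sigma>(\<pi> v) = -t\<^sup>-\<^sup>1 \<pi> v = t \<pi> v\<close> gives
\<open>\<sigma>(\<pi>\<^sub>i v\<^sub>i) = a \<pi>\<^sub>i v\<^sub>i\<close>, which is the rescaling of \<open>qbinom_rescale\<close>.\<close>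

lemma sig_qbinom:
  assumes "d > 0"
  shows "sig (qbinom (cov_v powi d) (cov_pi powi d) n k) =
    tpow (d * int k * (n - int k)) * qbinom (cov_v powi d) (cov_pi powi d) n k"
proof -
  define a where "a = gauss_t powi d"
  have a: "a \<noteq> 0" by (simp add: a_def gauss_t_nonzero)
  have v: "sig cov_v powi d = cov_const (inverse a) * cov_v powi d"
    by (simp add: sig_v power_int_cov_const_mult gauss_t_nonzero a_def power_int_inverse)
  obtain m where m: "d = int m" using assms by (metis zero_less_imp_eq_int)
  have "gauss_t * gauss_t = -1" by (rule gauss_t_squared)
  then have g: "- inverse gauss_t = gauss_t"
    using inverse_unique[of gauss_t "- gauss_t"] by simp
  have "(sig cov_pi powi d) * (sig cov_v powi d) = cov_const a * (cov_pi powi d * cov_v powi d)"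
  proof -
    have "(sig cov_pi * sig cov_v) ^ m = (cov_const gauss_t * (cov_pi * cov_v)) ^ m"
    proof -
      have "sig cov_pi * sig cov_v = cov_const (- inverse gauss_t) * (cov_pi * cov_v)"
        by (simp add: sig_pi sig_v cov_const_uminus mult.left_commute)
      then show ?thesis by (simp only: g)
    qed
    then show ?thesis
      by (simp add: m a_def power_mult_distrib cov_const_power)
  qed
  from qbinom_rescale[OF a v this] show ?thesis
    by (simp add: sig.qbinom sig.power_int a_def tpow_def power_int_mult flip: mult.assoc)
qed

section \<open>Finitely supported functions\<close>

lemma poly_mapping_keys_induct [consumes 1, case_names zero add_single]:
  fixes x :: "'k \<Rightarrow>\<^sub>0 'r::comm_monoid_add"
  assumes "Poly_Mapping.keys x \<subseteq> S" "P 0"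
    and step: "\<And>x k c. P x \<Longrightarrow> k \<in> S \<Longrightarrow> P (x + Poly_Mapping.single k c)"
  shows "P x"
  using assms(1)
proof (induction x rule: update_induct)
  case const
  then show ?case by (simp add: assms)
next
  case (update f a b)
  have "Poly_Mapping.update a b f = f + Poly_Mapping.single a b"
    using update.hyps
    by (intro poly_mapping_eqI) (auto simp: lookup_update lookup_add lookup_single in_keys_iff when_def)
  moreover have "Poly_Mapping.keys f \<subseteq> S" "a \<in> S"
    using update.prems update.hyps by (auto simp: keys_update)
  ultimately show ?case
    using step[OF update.IH] by simp
qed

lemmas poly_mapping_add_induct [case_names zero add_single] =
  poly_mapping_keys_induct[OF subset_UNIV, simplified]

lemma lookup_mapp_zero:
  assumes "\<And>k. f k 0 = 0"
  shows "Poly_Mapping.lookup (Poly_Mapping.mapp f x) k = f k (Poly_Mapping.lookup x k)"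
  by (simp add: lookup_mapp when_def in_keys_iff assms)

lemma mapp_single:
  assumes "\<And>k. f k 0 = 0"
  shows "Poly_Mapping.mapp f (Poly_Mapping.single k c) = Poly_Mapping.single k (f k c)"
  by (rule poly_mapping_eqI) (auto simp: lookup_mapp_zero assms lookup_single when_def)

lemma mapp_add:
  assumes "\<And>k. f k 0 = 0" "\<And>k a b. f k (a + b) = f k a + f k b"
  shows "Poly_Mapping.mapp f (x + y) = Poly_Mapping.mapp f x + Poly_Mapping.mapp f y"
  by (rule poly_mapping_eqI) (simp add: lookup_mapp_zero assms lookup_add)

text \<open>The additive extension of \<open>g\<close> to the free abelian group; unlike \<^const>\<open>frag_extend\<close> its values lie in
an arbitrary ring.\<close>

definition frag_eval :: "('k \<Rightarrow> 'r::ring_1) \<Rightarrow> ('k \<Rightarrow>\<^sub>0 int) \<Rightarrow> 'r" where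
  "frag_eval g u = (\<Sum>k\<in>Poly_Mapping.keys u. of_int (Poly_Mapping.lookup u k) * g k)"

lemma frag_eval_superset:
  assumes "finite S" "Poly_Mapping.keys u \<subseteq> S"
  shows "frag_eval g u = (\<Sum>k\<in>S. of_int (Poly_Mapping.lookup u k) * g k)"
  unfolding frag_eval_def using assms
  by (intro sum.mono_neutral_left) (auto simp: in_keys_iff)

lemma frag_eval_of [simp]: "frag_eval g (frag_of k) = g k"
  by (simp add: frag_eval_def)

lemma frag_eval_0 [simp]: "frag_eval g 0 = 0"
  by (simp add: frag_eval_def)

lemma frag_eval_diff: "frag_eval g (u - w) = frag_eval g u - frag_eval g w"
proof -
  have "Poly_Mapping.keys (u - w) \<subseteq> Poly_Mapping.keys u \<union> Poly_Mapping.keys w"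
    by (rule keys_diff)
  then show ?thesis
    by (simp add: frag_eval_superset[where S="Poly_Mapping.keys u \<union> Poly_Mapping.keys w"]
        lookup_minus left_diff_distrib sum_subtractf)
qed

lemma frag_eval_uminus: "frag_eval g (- u) = - frag_eval g u"
  using frag_eval_diff[of g 0 u] by simp

lemma frag_eval_add: "frag_eval g (u + w) = frag_eval g u + frag_eval g w"
  using frag_eval_diff[of g u "- w"] by (simp add: frag_eval_uminus)

section \<open>The free algebra over the larger ring of scalars\<close>

type_synonym 'i free_t = "'i fword \<Rightarrow>\<^sub>0 Qvt_pi"

definition free_t_scalar :: "Qvt_pi \<Rightarrow> 'i free_t" where
  "free_t_scalar c = Poly_Mapping.single 0 c"

definition free_incl :: "'i free_alg \<Rightarrow> 'i free_t" where
  "free_incl = Poly_Mapping.mapp (\<lambda>_. scalar_incl)"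

lemma free_t_scalar_mult: "free_t_scalar (c * d) = free_t_scalar c * free_t_scalar d"
  by (simp add: free_t_scalar_def mult_single)

lemma free_t_scalar_add: "free_t_scalar (c + d) = free_t_scalar c + free_t_scalar d"
  by (simp add: free_t_scalar_def single_add)

lemma free_t_scalar_1: "free_t_scalar 1 = 1"
  by (simp add: free_t_scalar_def)

text \<open>Scalars commute with words, although the algebra itself is not commutative.\<close>

lemma free_t_scalar_central: "x * free_t_scalar c = free_t_scalar c * x"
  by (induction x rule: poly_mapping_add_induct)
     (simp_all add: free_t_scalar_def mult_single distrib_left distrib_right mult.commute)

lemma free_incl_single: "free_incl (Poly_Mapping.single w c) = Poly_Mapping.single w (scalar_incl c)"
  by (simp add: free_incl_def mapp_single incl.zero)

lemma free_incl_add: "free_incl (x + y) = free_incl x + free_incl y"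
  by (simp add: free_incl_def mapp_add incl.zero incl.add)

lemma free_incl_0: "free_incl 0 = 0"
  using free_incl_add[of 0 0] by simp

lemma free_incl_diff: "free_incl (x - y) = free_incl x - free_incl y"
  using free_incl_add[of "x - y" y] by simp

lemma free_incl_mult: "free_incl (x * y) = free_incl x * free_incl y"
proof (induction x rule: poly_mapping_add_induct)
  case (add_single x u c)
  have "free_incl (Poly_Mapping.single u c * y) = free_incl (Poly_Mapping.single u c) * free_incl y"
    by (induction y rule: poly_mapping_add_induct)
       (simp_all add: free_incl_0 free_incl_add free_incl_single mult_single distrib_left incl.mult)
  with add_single show ?case
    by (simp add: free_incl_add distrib_right)
qed (simp add: free_incl_0)

lemma free_incl_scalar: "free_incl (free_scalar c) = free_t_scalar (scalar_incl c)"
  by (simp add: free_scalar_def free_t_scalar_def free_incl_single)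

lemma free_incl_1: "free_incl 1 = 1"
  using free_incl_scalar[of 1] by (simp add: free_scalar_def free_t_scalar_def incl.one)

lemma ring_free_ring: "ring (free_ring :: 'i free_alg ring)"
proof -
  have "\<exists>y. x + y = 0" for x :: "'i free_alg"
    using add.right_inverse by blast
  then show ?thesis
    unfolding ring_of_type_algebra_def using add.right_inverse
    by unfold_locales (auto simp: algebra_simps Units_def)
qed

lemma free_ring_sel [simp]:
  "carrier free_ring = UNIV" "x \<otimes>\<^bsub>free_ring\<^esub> y = x * y" "x \<oplus>\<^bsub>free_ring\<^esub> y = x + y"
  "\<one>\<^bsub>free_ring\<^esub> = 1" "\<zero>\<^bsub>free_ring\<^esub> = 0"
  by (simp_all add: ring_of_type_algebra_def)

context
  fixes dot :: "'i \<Rightarrow> 'i \<Rightarrow> int" and I1 :: "'i set"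
begin

text \<open>The two-sided ideal generated by the Serre elements over the larger ring of scalars. A coefficient on
each side of the generator makes closure under multiplication from either side immediate.\<close>

inductive_set serre_span :: "'i free_t set" where
  zero: "0 \<in> serre_span"
| step: "x \<in> serre_span \<Longrightarrow> i \<noteq> j \<Longrightarrow>
    x + Poly_Mapping.single u c * free_incl (serre dot I1 i j) * Poly_Mapping.single w d \<in> serre_span"

lemma serre_span_add:
  assumes "x \<in> serre_span" "y \<in> serre_span"
  shows "x + y \<in> serre_span"
  using assms(2)
  by (induction rule: serre_span.induct) (auto simp: assms(1) simp flip: add.assoc intro: serre_span.step)

lemma serre_span_gen:
  "i \<noteq> j \<Longrightarrow> Poly_Mapping.single u c * free_incl (serre dot I1 i j) * Poly_Mapping.single w d \<in> serre_span"
  using serre_span.step[OF serre_span.zero] by simp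

lemma serre_span_uminus: "x \<in> serre_span \<Longrightarrow> - x \<in> serre_span"
proof (induction rule: serre_span.induct)
  case (step x i j u c w d)
  have "Poly_Mapping.single u (- c) * free_incl (serre dot I1 i j) * Poly_Mapping.single w d \<in> serre_span"
    using step.hyps by (intro serre_span_gen)
  with step.IH show ?case
    using serre_span_add by (fastforce simp: single_uminus)
qed (simp add: serre_span.zero)

lemma serre_span_diff: "x \<in> serre_span \<Longrightarrow> y \<in> serre_span \<Longrightarrow> x - y \<in> serre_span"
  using serre_span_add[of x "- y"] serre_span_uminus by simp

lemma serre_span_mult_left: "x \<in> serre_span \<Longrightarrow> y * x \<in> serre_span"
proof (induction y rule: poly_mapping_add_induct)
  case (add_single y v e)
  have "Poly_Mapping.single v e * x \<in> serre_span"
    using add_single.prems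
  proof (induction rule: serre_span.induct)
    case (step x i j u c w d)
    have "Poly_Mapping.single (v + u) (e * c) * free_incl (serre dot I1 i j) * Poly_Mapping.single w d \<in> serre_span"
      using step.hyps by (intro serre_span_gen)
    with step.IH show ?case
      using serre_span_add by (fastforce simp: distrib_left mult_single simp flip: mult.assoc)
  qed (simp add: serre_span.zero)
  with add_single show ?case
    by (simp add: distrib_right serre_span_add)
qed (simp add: serre_span.zero)

lemma serre_span_mult_right: "x \<in> serre_span \<Longrightarrow> x * y \<in> serre_span"
proof (induction y rule: poly_mapping_add_induct)
  case (add_single y v e)
  have "x * Poly_Mapping.single v e \<in> serre_span"
    using add_single.prems
  proof (induction rule: serre_span.induct)
    case (step x i j u c w d)
    have "Poly_Mapping.single u c * free_incl (serre dot I1 i j) * Poly_Mapping.single (w + v) (d * e) \<in> serre_span"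
      using step.hyps by (intro serre_span_gen)
    with step.IH show ?case
      using serre_span_add by (fastforce simp: distrib_right mult_single mult.assoc)
  qed (simp add: serre_span.zero)
  with add_single show ?case
    by (simp add: distrib_left serre_span_add)
qed (simp add: serre_span.zero)

definition serre_cong :: "'i free_t \<Rightarrow> 'i free_t \<Rightarrow> bool" (infix "\<doteq>" 50) where
  "x \<doteq> y \<longleftrightarrow> x - y \<in> serre_span"

lemma cong_refl [simp]: "x \<doteq> x"
  by (simp add: serre_cong_def serre_span.zero)

lemma cong_sym: "x \<doteq> y \<Longrightarrow> y \<doteq> x"
  using serre_span_uminus[of "x - y"] by (simp add: serre_cong_def)

lemma cong_trans [trans]: "x \<doteq> y \<Longrightarrow> y \<doteq> z \<Longrightarrow> x \<doteq> z"
  using serre_span_add[of "x - y" "y - z"] by (simp add: serre_cong_def)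

lemma cong_add: "x \<doteq> x' \<Longrightarrow> y \<doteq> y' \<Longrightarrow> x + y \<doteq> x' + y'"
  using serre_span_add[of "x - x'" "y - y'"] by (simp add: serre_cong_def algebra_simps)

lemma cong_diff: "x \<doteq> x' \<Longrightarrow> y \<doteq> y' \<Longrightarrow> x - y \<doteq> x' - y'"
  using serre_span_diff[of "x - x'" "y - y'"] by (simp add: serre_cong_def algebra_simps)

lemma cong_mult: "x \<doteq> x' \<Longrightarrow> y \<doteq> y' \<Longrightarrow> x * y \<doteq> x' * y'"
  using serre_span_add[OF serre_span_mult_right[of "x - x'" y] serre_span_mult_left[of "y - y'" x']]
  by (simp add: serre_cong_def algebra_simps)

lemma cong_0_iff: "x \<doteq> 0 \<longleftrightarrow> x \<in> serre_span"
  by (simp add: serre_cong_def)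

section \<open>The half covering quantum group as a quotient of the free algebra\<close>

lemma ideal_serre_ideal: "ideal (serre_ideal dot I1) (free_ring :: 'i free_alg ring)"
  unfolding serre_ideal_def by (rule ring.genideal_ideal[OF ring_free_ring]) simp

interpretation SI: ideal "serre_ideal dot I1" "free_ring :: 'i free_alg ring"
  by (rule ideal_serre_ideal)

lemma in_half_class_iff: "y \<in> half_class dot I1 x \<longleftrightarrow> y - x \<in> serre_ideal dot I1"
  by (auto simp: half_class_def a_r_coset_def' eq_diff_eq intro: bexI[of _ "y - x"])

lemma serre_ideal_diff:
  assumes "x \<in> serre_ideal dot I1" "y \<in> serre_ideal dot I1"
  shows "x - y \<in> serre_ideal dot I1"
  using additive_subgroup.a_closed[OF SI.additive_subgroup_axioms assms(1) SI.I_l_closed[OF assms(2), of "- 1"]]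
  by simp

lemma half_class_eqI:
  assumes "x - y \<in> serre_ideal dot I1"
  shows "half_class dot I1 x = half_class dot I1 y"
proof -
  have "z - x \<in> serre_ideal dot I1 \<longleftrightarrow> z - y \<in> serre_ideal dot I1" for z
    using additive_subgroup.a_closed[OF SI.additive_subgroup_axioms _ assms, of "z - x"] serre_ideal_diff[OF _ assms, of "z - y"]
    by auto
  then show ?thesis by (auto simp: in_half_class_iff)
qed

lemma half_cqg_carrier: "carrier (half_cqg dot I1) = range (half_class dot I1)"
  by (auto simp: half_cqg_def Let_def FactRing_def A_RCOSETS_def' half_class_def ring.defs module.defs)

lemma half_cqg_mult:
  "half_class dot I1 x \<otimes>\<^bsub>half_cqg dot I1\<^esub> half_class dot I1 y = half_class dot I1 (x * y)"
  using SI.rcoset_mult_add[of x y]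
  by (simp add: half_cqg_def Let_def FactRing_def half_class_def ring.defs module.defs)

lemma half_cqg_add:
  "half_class dot I1 x \<oplus>\<^bsub>half_cqg dot I1\<^esub> half_class dot I1 y = half_class dot I1 (x + y)"
  using SI.a_rcos_sum[of x y]
  by (simp add: half_cqg_def Let_def FactRing_def half_class_def ring.defs module.defs)

lemma half_cqg_one: "\<one>\<^bsub>half_cqg dot I1\<^esub> = half_class dot I1 1"
  by (simp add: half_cqg_def Let_def FactRing_def half_class_def ring.defs module.defs)

lemma half_cqg_smult:
  "c \<odot>\<^bsub>half_cqg dot I1\<^esub> half_class dot I1 x = half_class dot I1 (free_scalar c * x)"
  using SI.rcoset_mult_add[of "free_scalar c" x]
  by (simp add: half_cqg_def Let_def FactRing_def half_class_def ring.defs module.defs)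

text \<open>The elements whose image lies in the larger ideal form an ideal containing the Serre elements.\<close>

lemma serre_ideal_subset: "x \<in> serre_ideal dot I1 \<Longrightarrow> free_incl x \<in> serre_span"
proof -
  have "ideal {x. free_incl x \<in> serre_span} (free_ring :: 'i free_alg ring)"
  proof (rule idealI[OF ring_free_ring])
    show "subgroup {x. free_incl x \<in> serre_span} (add_monoid (free_ring :: 'i free_alg ring))"
    proof (rule group.subgroupI[OF SI.a_group])
      fix x :: "'i free_alg" assume "x \<in> {x. free_incl x \<in> serre_span}"
      moreover have "inv\<^bsub>add_monoid free_ring\<^esub> x = - x"
        using SI.minus_equality[of "- x" x] by (simp add: a_inv_def)
      ultimately show "inv\<^bsub>add_monoid free_ring\<^esub> x \<in> {x. free_incl x \<in> serre_span}"
        using free_incl_diff[of 0 x] by (simp add: free_incl_0 serre_span_uminus)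
    qed (auto simp: free_incl_add serre_span_add intro!: exI[of _ 0] simp: free_incl_0 serre_span.zero)
  qed (simp_all add: free_incl_mult serre_span_mult_left serre_span_mult_right)
  moreover have "free_incl (serre dot I1 i j) \<in> serre_span" if "i \<noteq> j" for i j
    using serre_span_gen[OF that, of 0 1 0 1] by simp
  ultimately have "serre_ideal dot I1 \<subseteq> {x. free_incl x \<in> serre_span}"
    unfolding serre_ideal_def by (intro ring.genideal_minimal[OF ring_free_ring]) auto
  then show "x \<in> serre_ideal dot I1 \<Longrightarrow> free_incl x \<in> serre_span"
    by blast
qed

section \<open>The base change as a quotient of the free algebra\<close>

abbreviation TF :: "(Qvt_pi \<times> 'i free_alg set \<Rightarrow>\<^sub>0 int) monoid" where
  "TF \<equiv> tensor_free (half_cqg dot I1)"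

abbreviation TR :: "(Qvt_pi \<times> 'i free_alg set \<Rightarrow>\<^sub>0 int) set" where
  "TR \<equiv> tensor_rels scalar_incl (half_cqg dot I1)"

text \<open>The value \<open>\<Sum> b x\<close> in the free algebra of a formal sum of pairs \<open>(b, [x])\<close>. A coset is evaluated at
an arbitrary representative, so the value is meaningful only modulo the Serre ideal.\<close>

definition tensor_lift :: "(Qvt_pi \<times> 'i free_alg set \<Rightarrow>\<^sub>0 int) \<Rightarrow> 'i free_t" where
  "tensor_lift = frag_eval (\<lambda>(b, K). free_t_scalar b * free_incl (SOME x. x \<in> K))"

lemma tensor_lift_0: "tensor_lift 0 = 0"
  by (simp add: tensor_lift_def)

lemma tensor_lift_diff: "tensor_lift (u - w) = tensor_lift u - tensor_lift w"
  by (simp add: tensor_lift_def frag_eval_diff)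

lemma tensor_lift_uminus: "tensor_lift (- u) = - tensor_lift u"
  by (simp add: tensor_lift_def frag_eval_uminus)

lemma tensor_lift_add: "tensor_lift (u + w) = tensor_lift u + tensor_lift w"
  by (simp add: tensor_lift_def frag_eval_add)

lemmas tensor_lift_simps = tensor_lift_0 tensor_lift_diff tensor_lift_uminus tensor_lift_add

lemma half_class_self: "x \<in> half_class dot I1 x"
  using additive_subgroup.zero_closed[OF SI.additive_subgroup_axioms] by (simp add: in_half_class_iff)

lemma half_class_SOME: "half_class dot I1 (SOME y. y \<in> half_class dot I1 x) = half_class dot I1 x"
  using someI[of "\<lambda>y. y \<in> half_class dot I1 x", OF half_class_self]
  by (intro half_class_eqI) (simp add: in_half_class_iff)

lemma half_class_rep: "free_incl (SOME y. y \<in> half_class dot I1 x) \<doteq> free_incl x"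
  using someI[of "\<lambda>y. y \<in> half_class dot I1 x", OF half_class_self]
  by (simp add: in_half_class_iff serre_cong_def serre_ideal_subset flip: free_incl_diff)

lemma tensor_lift_of: "tensor_lift (frag_of (b, half_class dot I1 x)) \<doteq> free_t_scalar b * free_incl x"
  by (simp add: tensor_lift_def cong_mult half_class_rep)

lemma TF_carrier: "carrier TF = {u. Poly_Mapping.keys u \<subseteq> UNIV \<times> range (half_class dot I1)}"
  by (simp add: tensor_free_def free_Abelian_group_def half_cqg_carrier)

lemma comm_group_TF: "comm_group TF"
  by (simp add: tensor_free_def abelian_free_Abelian_group)

lemma TF_mult [simp]: "u \<otimes>\<^bsub>TF\<^esub> w = u + w"
  by (simp add: tensor_free_def)

lemma TF_one [simp]: "\<one>\<^bsub>TF\<^esub> = 0"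
  by (simp add: tensor_free_def)

lemma TF_inv: "u \<in> carrier TF \<Longrightarrow> inv\<^bsub>TF\<^esub> u = - u"
  by (simp add: tensor_free_def)

lemma TF_diff: "u \<in> carrier TF \<Longrightarrow> w \<in> carrier TF \<Longrightarrow> u - w \<in> carrier TF"
  using keys_diff[of u w] by (auto simp: TF_carrier)

lemma TF_add: "u \<in> carrier TF \<Longrightarrow> w \<in> carrier TF \<Longrightarrow> u + w \<in> carrier TF"
  using keys_add[of u w] by (auto simp: TF_carrier)

lemma TF_0 [simp]: "0 \<in> carrier TF"
  by (simp add: TF_carrier)

lemma TF_of [simp]: "frag_of (b, half_class dot I1 x) \<in> carrier TF"
  by (simp add: TF_carrier)

lemma TF_induct [consumes 1, case_names zero of diff]:
  assumes "u \<in> carrier TF" "P 0" "\<And>b x. P (frag_of (b, half_class dot I1 x))"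
    "\<And>u w. P u \<Longrightarrow> P w \<Longrightarrow> P (u - w)"
  shows "P u"
  by (rule frag_induction[where S="UNIV \<times> range (half_class dot I1)"])
     (use assms in \<open>auto simp: TF_carrier\<close>)

text \<open>The generators of the relations of the tensor product, for cosets of the Serre ideal.\<close>

definition tensor_gens :: "(Qvt_pi \<times> 'i free_alg set \<Rightarrow>\<^sub>0 int) set" where
  "tensor_gens =
    {frag_of (b + b', x) - frag_of (b, x) - frag_of (b', x) | b b' x. x \<in> carrier (half_cqg dot I1)} \<union>
     {frag_of (b, x \<oplus>\<^bsub>half_cqg dot I1\<^esub> y) - frag_of (b, x) - frag_of (b, y) | b x y.
        x \<in> carrier (half_cqg dot I1) \<and> y \<in> carrier (half_cqg dot I1)} \<union>
     {frag_of (b * scalar_incl a, x) - frag_of (b, a \<odot>\<^bsub>half_cqg dot I1\<^esub> x) | a b x.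
        x \<in> carrier (half_cqg dot I1)}"

lemma TR_eq: "TR = generate TF tensor_gens"
  by (simp add: tensor_rels_def tensor_gens_def)

lemma tensor_gens_cases [consumes 1, case_names scalar_add class_add balanced]:
  assumes "u \<in> tensor_gens"
  obtains b b' x where "u = frag_of (b + b', half_class dot I1 x) - frag_of (b, half_class dot I1 x) -
       frag_of (b', half_class dot I1 x)"
  | b x y where "u = frag_of (b, half_class dot I1 (x + y)) - frag_of (b, half_class dot I1 x) -
       frag_of (b, half_class dot I1 y)"
  | a b x where "u = frag_of (b * scalar_incl a, half_class dot I1 x) -
       frag_of (b, half_class dot I1 (free_scalar a * x))"
  using assms unfolding tensor_gens_def half_cqg_carrier
  by (auto simp: half_cqg_add half_cqg_smult)

lemma TR_scalar_add: "frag_of (b + b', half_class dot I1 x) - frag_of (b, half_class dot I1 x) -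
       frag_of (b', half_class dot I1 x) \<in> TR"
  unfolding TR_eq tensor_gens_def half_cqg_carrier by (rule generate.incl) blast

lemma TR_class_add: "frag_of (b, half_class dot I1 (x + y)) - frag_of (b, half_class dot I1 x) -
       frag_of (b, half_class dot I1 y) \<in> TR"
  unfolding TR_eq tensor_gens_def half_cqg_carrier half_cqg_add[symmetric] by (rule generate.incl) blast

lemma TR_balanced: "frag_of (b * scalar_incl a, half_class dot I1 x) -
       frag_of (b, half_class dot I1 (free_scalar a * x)) \<in> TR"
  unfolding TR_eq tensor_gens_def half_cqg_carrier half_cqg_smult[symmetric] by (rule generate.incl) blast

lemma tensor_gens_carrier: "tensor_gens \<subseteq> carrier TF"
  by (auto elim!: tensor_gens_cases intro!: TF_diff)

lemma subgroup_TR: "subgroup TR TF"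
  unfolding TR_eq
  by (rule group.generate_is_subgroup[OF comm_group.axioms(2)[OF comm_group_TF] tensor_gens_carrier])

lemma TR_carrier: "u \<in> TR \<Longrightarrow> u \<in> carrier TF"
  using subgroup.mem_carrier[OF subgroup_TR] .

lemma TR_0: "0 \<in> TR"
  using subgroup.one_closed[OF subgroup_TR] by simp

lemma TR_add: "u \<in> TR \<Longrightarrow> w \<in> TR \<Longrightarrow> u + w \<in> TR"
  using subgroup.m_closed[OF subgroup_TR] by simp

lemma TR_uminus: "u \<in> TR \<Longrightarrow> - u \<in> TR"
  using subgroup.m_inv_closed[OF subgroup_TR] by (simp add: TF_inv TR_carrier)

lemma TR_diff: "u \<in> TR \<Longrightarrow> w \<in> TR \<Longrightarrow> u - w \<in> TR"
  using TR_add[of u "- w"] TR_uminus[of w] by simp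

lemma tensor_lift_gens: "u \<in> tensor_gens \<Longrightarrow> tensor_lift u \<in> serre_span"
proof -
  have 1: "tensor_lift (frag_of (b + b', K) - frag_of (b, K) - frag_of (b', K)) = 0" for b b' K
    by (simp add: tensor_lift_def frag_eval_diff free_t_scalar_add distrib_right)
  have 2: "tensor_lift (frag_of (b, half_class dot I1 (x + y)) - frag_of (b, half_class dot I1 x) -
       frag_of (b, half_class dot I1 y)) \<doteq> 0" for b x y
  proof -
    have "tensor_lift (frag_of (b, half_class dot I1 (x + y)) - frag_of (b, half_class dot I1 x) -
       frag_of (b, half_class dot I1 y)) \<doteq>
       free_t_scalar b * free_incl (x + y) - free_t_scalar b * free_incl x - free_t_scalar b * free_incl y"
      unfolding tensor_lift_simps by (intro cong_diff tensor_lift_of)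
    then show ?thesis by (simp add: free_incl_add algebra_simps)
  qed
  have 3: "tensor_lift (frag_of (b * scalar_incl a, half_class dot I1 x) -
       frag_of (b, half_class dot I1 (free_scalar a * x))) \<doteq> 0" for a b x
  proof -
    have "tensor_lift (frag_of (b * scalar_incl a, half_class dot I1 x) -
       frag_of (b, half_class dot I1 (free_scalar a * x))) \<doteq>
       free_t_scalar (b * scalar_incl a) * free_incl x - free_t_scalar b * free_incl (free_scalar a * x)"
      unfolding tensor_lift_simps by (intro cong_diff tensor_lift_of)
    then show ?thesis
      by (simp add: free_t_scalar_mult free_incl_mult free_incl_scalar mult.assoc)
  qed
  show "u \<in> tensor_gens \<Longrightarrow> tensor_lift u \<in> serre_span"
    by (cases rule: tensor_gens_cases)
       (auto simp: 1 serre_span.zero intro: 2[unfolded cong_0_iff] 3[unfolded cong_0_iff])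
qed

lemma tensor_lift_rels: "u \<in> TR \<Longrightarrow> tensor_lift u \<in> serre_span"
  unfolding TR_eq
proof (induction rule: generate.induct)
  case (inv h)
  then have "inv\<^bsub>TF\<^esub> h = - h"
    using tensor_gens_carrier by (intro TF_inv) auto
  with inv show ?case
    by (simp add: tensor_lift_uminus serre_span_uminus tensor_lift_gens)
qed (auto simp: tensor_lift_simps serre_span.zero serre_span_add tensor_lift_gens)

text \<open>A section of \<^const>\<open>tensor_lift\<close>: an element of the free algebra is written as the formal sum of its terms. It
is additive only modulo the tensor relations.\<close>

definition tensor_section :: "'i free_t \<Rightarrow> (Qvt_pi \<times> 'i free_alg set \<Rightarrow>\<^sub>0 int)" where
  "tensor_section x = (\<Sum>w\<in>Poly_Mapping.keys x.
     frag_of (Poly_Mapping.lookup x w, half_class dot I1 (Poly_Mapping.single w 1)))"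

lemma TR_frag_0: "frag_of (0, half_class dot I1 x) \<in> TR"
  using TR_uminus[OF TR_scalar_add[of 0 0 x]] by simp

lemma TR_sum: "(\<And>i. i \<in> S \<Longrightarrow> g i \<in> TR) \<Longrightarrow> sum g S \<in> TR"
  by (induction S rule: infinite_finite_induct) (auto simp: TR_0 TR_add)

lemma tensor_section_superset:
  assumes "finite S" "Poly_Mapping.keys x \<subseteq> S"
  shows "(\<Sum>w\<in>S. frag_of (Poly_Mapping.lookup x w, half_class dot I1 (Poly_Mapping.single w 1)))
    - tensor_section x \<in> TR"
proof -
  have "(\<Sum>w\<in>S. frag_of (Poly_Mapping.lookup x w, half_class dot I1 (Poly_Mapping.single w 1)))
    - tensor_section x = (\<Sum>w\<in>S - Poly_Mapping.keys x.
        frag_of (Poly_Mapping.lookup x w, half_class dot I1 (Poly_Mapping.single w 1)))"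
    using assms by (simp add: tensor_section_def sum.subset_diff)
  also have "\<dots> \<in> TR"
    by (rule TR_sum) (simp add: in_keys_iff TR_frag_0)
  finally show ?thesis .
qed

lemma tensor_section_add:
  "tensor_section (x + y) - tensor_section x - tensor_section y \<in> TR"
proof -
  let ?S = "Poly_Mapping.keys x \<union> Poly_Mapping.keys y"
  let ?t = "\<lambda>x. \<Sum>w\<in>?S. frag_of (Poly_Mapping.lookup x w, half_class dot I1 (Poly_Mapping.single w 1))"
  have "?t (x + y) - ?t x - ?t y \<in> TR"
    unfolding sum_subtractf[symmetric] lookup_add
    by (intro TR_sum TR_scalar_add)
  moreover have "?t (x + y) - tensor_section (x + y) \<in> TR"
    by (rule tensor_section_superset) (use keys_add[of x y] in auto)
  moreover have "?t x - tensor_section x \<in> TR"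
      "?t y - tensor_section y \<in> TR"
    by (rule tensor_section_superset; auto)+
  ultimately have "(?t (x + y) - ?t x - ?t y) - (?t (x + y) - tensor_section (x + y)) +
      (?t x - tensor_section x) + (?t y - tensor_section y) \<in> TR"
    by (rule TR_add[OF TR_add[OF TR_diff]])
  then show ?thesis by (simp add: algebra_simps)
qed

lemma tensor_section_single:
  "tensor_section (Poly_Mapping.single w c) - frag_of (c, half_class dot I1 (Poly_Mapping.single w 1)) \<in> TR"
  by (cases "c = 0") (auto simp: tensor_section_def TR_0 intro: TR_uminus TR_frag_0)

text \<open>By additivity it suffices to treat a single term \<open>a w\<close> of \<open>x\<close>, and there the scalar \<open>a\<close> can be moved across the
tensor sign.\<close>

lemma tensor_section_pure:
  "tensor_section (free_t_scalar b * free_incl x) - frag_of (b, half_class dot I1 x) \<in> TR"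
proof (induction x rule: poly_mapping_add_induct)
  case zero
  then show ?case
    using TR_class_add[of b 0 0] by (simp add: free_incl_0 tensor_section_def)
next
  case (add_single x w a)
  let ?f = "\<lambda>b x. frag_of (b, half_class dot I1 x)"
  let ?c = "free_t_scalar b"
  have eq: "?c * free_incl (Poly_Mapping.single w a) = Poly_Mapping.single w (b * scalar_incl a)"
    by (simp add: free_t_scalar_def free_incl_single mult_single)
  have 1: "tensor_section (?c * free_incl (x + Poly_Mapping.single w a)) -
      tensor_section (?c * free_incl x) - tensor_section (Poly_Mapping.single w (b * scalar_incl a)) \<in> TR"
    using tensor_section_add by (simp add: free_incl_add distrib_left eq)
  have 2: "?f b (x + Poly_Mapping.single w a) - ?f b x - ?f b (Poly_Mapping.single w a) \<in> TR"
    by (rule TR_class_add)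
  have "?f (b * scalar_incl a) (Poly_Mapping.single w 1) -
      ?f b (free_scalar a * Poly_Mapping.single w 1) \<in> TR"
    by (rule TR_balanced)
  then have 3: "?f (b * scalar_incl a) (Poly_Mapping.single w 1) - ?f b (Poly_Mapping.single w a) \<in> TR"
    by (simp add: free_scalar_def mult_single)
  \<comment> \<open>A telescoping sum of relations; everything cancels except the two outer terms.\<close>
  have "(tensor_section (?c * free_incl (x + Poly_Mapping.single w a)) -
      tensor_section (?c * free_incl x) - tensor_section (Poly_Mapping.single w (b * scalar_incl a))) +
      (tensor_section (?c * free_incl x) - ?f b x) +
      (tensor_section (Poly_Mapping.single w (b * scalar_incl a)) - ?f (b * scalar_incl a) (Poly_Mapping.single w 1)) +
      (?f (b * scalar_incl a) (Poly_Mapping.single w 1) - ?f b (Poly_Mapping.single w a)) -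
      (?f b (x + Poly_Mapping.single w a) - ?f b x - ?f b (Poly_Mapping.single w a)) \<in> TR"
    by (rule TR_diff[OF TR_add[OF TR_add[OF TR_add[OF 1 add_single] tensor_section_single] 3] 2])
  then show ?case by (simp add: algebra_simps)
qed

lemma tensor_section_diff:
  "tensor_section (x - y) - (tensor_section x - tensor_section y) \<in> TR"
  using TR_uminus[OF tensor_section_add[of "x - y" y]] by (simp add: algebra_simps)

lemma tensor_section_lift: "u \<in> carrier TF \<Longrightarrow> tensor_section (tensor_lift u) - u \<in> TR"
proof (induction rule: TF_induct)
  case zero
  then show ?case by (simp add: tensor_lift_0) (simp add: tensor_section_def TR_0)
next
  case (of b x)
  then show ?case
    using tensor_section_pure[of b "SOME y. y \<in> half_class dot I1 x"]
    by (simp add: tensor_lift_def half_class_SOME)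
next
  case (diff u w)
  have "(tensor_section (tensor_lift u - tensor_lift w) - (tensor_section (tensor_lift u) - tensor_section (tensor_lift w)))
     + (tensor_section (tensor_lift u) - u) - (tensor_section (tensor_lift w) - w) \<in> TR"
    by (rule TR_diff[OF TR_add[OF tensor_section_diff diff(1)] diff(2)])
  then show ?case by (simp add: tensor_lift_simps algebra_simps)
qed

text \<open>All the scalars in a generator can be collected in the left tensor factor, and then the right one is a
multiple of a Serre element over the small ring of scalars, hence zero.\<close>

lemma tensor_section_serre_span: "x \<in> serre_span \<Longrightarrow> tensor_section x \<in> TR"
proof (induction rule: serre_span.induct)
  case zero
  then show ?case by (simp add: tensor_section_def TR_0)
next
  case (step x i j u c w d)
  let ?y = "Poly_Mapping.single u 1 * serre dot I1 i j * Poly_Mapping.single w 1"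
  have g: "Poly_Mapping.single u c * free_incl (serre dot I1 i j) * Poly_Mapping.single w d
      = free_t_scalar (c * d) * free_incl ?y"
  proof -
    let ?s = "Poly_Mapping.single u 1 * free_incl (serre dot I1 i j)"
    have "Poly_Mapping.single u c * free_incl (serre dot I1 i j) * Poly_Mapping.single w d
      = free_t_scalar c * (?s * free_t_scalar d) * Poly_Mapping.single w 1"
      by (simp add: free_t_scalar_def mult_single flip: mult.assoc)
         (simp add: free_t_scalar_def mult_single mult.assoc)
    also have "?s * free_t_scalar d = free_t_scalar d * ?s"
      by (rule free_t_scalar_central)
    finally show ?thesis
      by (simp add: free_incl_mult free_incl_single incl.one free_t_scalar_mult mult.assoc)
  qed
  have "serre dot I1 i j \<in> serre_ideal dot I1"
    unfolding serre_ideal_def using step.hyps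
    by (intro ring.genideal_self[OF ring_free_ring, THEN subsetD]) auto
  then have "?y \<in> serre_ideal dot I1"
    using SI.I_l_closed SI.I_r_closed by fastforce
  then have "half_class dot I1 ?y = half_class dot I1 0"
    by (intro half_class_eqI) simp
  then have "tensor_section (free_t_scalar (c * d) * free_incl ?y) - frag_of (c * d, half_class dot I1 0) \<in> TR"
    by (metis tensor_section_pure)
  moreover have "frag_of (c * d, half_class dot I1 0) \<in> TR"
    using TR_uminus[OF tensor_section_pure[of "c * d" 0]] by (simp add: free_incl_0 tensor_section_def)
  ultimately have y: "tensor_section (free_t_scalar (c * d) * free_incl ?y) \<in> TR"
    using TR_add by fastforce
  have "tensor_section (x + free_t_scalar (c * d) * free_incl ?y) - tensor_section x -
      tensor_section (free_t_scalar (c * d) * free_incl ?y) + tensor_section x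
      + tensor_section (free_t_scalar (c * d) * free_incl ?y) \<in> TR"
    by (rule TR_add[OF TR_add[OF tensor_section_add step.IH] y])
  then show ?case by (simp add: g)
qed

text \<open>Injectivity of \<open>\<rat>(v,t)\<^sup>\<pi> \<otimes> f \<rightarrow> A / J\<close>, for \<open>J\<close> the Serre ideal: if the value of \<open>u\<close> lies in
\<open>J\<close>, then the section of that value is a relation, and it differs from \<open>u\<close> by a relation. Every statement about the tensor product
becomes in this way a statement about the free algebra modulo \<open>J\<close>.\<close>

lemma tensor_rels_iff: "u \<in> TR \<longleftrightarrow> u \<in> carrier TF \<and> tensor_lift u \<in> serre_span"
proof (intro iffI conjI)
  assume u: "u \<in> carrier TF \<and> tensor_lift u \<in> serre_span"
  then have "tensor_section (tensor_lift u) - (tensor_section (tensor_lift u) - u) \<in> TR"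
    by (intro TR_diff[OF tensor_section_serre_span tensor_section_lift]) auto
  then show "u \<in> TR" by simp
qed (auto simp: TR_carrier tensor_lift_rels)

end

section \<open>Presentation of the extended algebra\<close>

text \<open>The element of \<open>f[t]\<close> represented by an element of the free algebra. As a set of formal
sums this is a full coset of the tensor relations, described without choosing a representative.\<close>

definition free_class ::
    "('i \<Rightarrow> 'i \<Rightarrow> int) \<Rightarrow> 'i set \<Rightarrow> 'i free_t \<Rightarrow> 'i half_t" where
  "free_class dot I1 x = {u \<in> carrier (TF dot I1). serre_cong dot I1 (tensor_lift u) x}"

context
  fixes dot :: "'i \<Rightarrow> 'i \<Rightarrow> int" and I1 :: "'i set"
begin

private abbreviation (input) "hc \<equiv> half_class dot I1"
private abbreviation (input) "F \<equiv> half_cqg_t dot I1"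
private abbreviation (input) "Q \<equiv> free_class dot I1"

lemma tensor_lift_onto: "\<exists>u\<in>carrier (TF dot I1). serre_cong dot I1 (tensor_lift u) x"
proof (induction x rule: poly_mapping_add_induct)
  case zero
  show ?case by (rule bexI[of _ 0]) (simp_all add: tensor_lift_0)
next
  case (add_single x w c)
  then obtain u where u: "u \<in> carrier (TF dot I1)" "serre_cong dot I1 (tensor_lift u) x"
    by blast
  have "serre_cong dot I1 (tensor_lift (frag_of (c, hc (Poly_Mapping.single w 1)))) (Poly_Mapping.single w c)"
    using tensor_lift_of[of dot I1 c "Poly_Mapping.single w 1"]
    by (simp add: free_t_scalar_def free_incl_single incl.one mult_single)
  with u show ?case
    by (intro bexI[of _ "u + frag_of (c, hc (Poly_Mapping.single w 1))"])
       (auto simp: tensor_lift_add intro: cong_add TF_add)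
qed

lemma free_class_eq_iff: "Q x = Q y \<longleftrightarrow> serre_cong dot I1 x y"
proof
  assume eq: "Q x = Q y"
  obtain u where "u \<in> Q x"
    using tensor_lift_onto[of x] by (auto simp: free_class_def)
  with eq have "serre_cong dot I1 (tensor_lift u) x" "serre_cong dot I1 (tensor_lift u) y"
    by (auto simp: free_class_def)
  then show "serre_cong dot I1 x y"
    using cong_sym cong_trans by blast
next
  assume "serre_cong dot I1 x y"
  then show "Q x = Q y"
    unfolding free_class_def using cong_sym cong_trans by blast
qed

lemma free_class_nonempty: "\<exists>u. u \<in> Q x"
  using tensor_lift_onto[of x] by (auto simp: free_class_def)

lemma tensor_class_eq:
  assumes "u \<in> carrier (TF dot I1)"
  shows "tensor_class scalar_incl (half_cqg dot I1) u = Q (tensor_lift u)"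
proof -
  have "w \<in> tensor_class scalar_incl (half_cqg dot I1) u \<longleftrightarrow> w - u \<in> TR dot I1" for w
    by (auto simp: tensor_class_def r_coset_def intro: bexI[of _ "w - u"])
  moreover have "w - u \<in> TR dot I1 \<longleftrightarrow> w \<in> Q (tensor_lift u)" for w
    using TF_add[of "w - u" dot I1 u] TF_diff[of w dot I1 u] assms
    by (auto simp: tensor_rels_iff free_class_def serre_cong_def tensor_lift_diff)
  ultimately show ?thesis by auto
qed

lemma pure_tensor_eq:
  "pure_tensor scalar_incl (half_cqg dot I1) c (hc x) = Q (free_t_scalar c * free_incl x)"
  by (simp add: pure_tensor_def tensor_class_eq free_class_eq_iff tensor_lift_of)

lemma half_cqg_t_carrier: "carrier F = range Q"
proof -
  have "carrier F = tensor_class scalar_incl (half_cqg dot I1) ` carrier (TF dot I1)"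
    by (auto simp: half_cqg_t_def base_change_def Let_def FactGroup_def RCOSETS_def tensor_class_def)
  also have "\<dots> = range Q"
  proof (intro equalityI subsetI)
    fix K assume "K \<in> range Q"
    then obtain x where x: "K = Q x" by blast
    obtain u where "u \<in> carrier (TF dot I1)" "serre_cong dot I1 (tensor_lift u) x"
      using tensor_lift_onto by blast
    then show "K \<in> tensor_class scalar_incl (half_cqg dot I1) ` carrier (TF dot I1)"
      using x by (intro image_eqI[of _ _ u]) (auto simp: tensor_class_eq free_class_eq_iff cong_sym)
  qed (auto simp: tensor_class_eq)
  finally show ?thesis .
qed

lemma half_cqg_t_add: "Q x \<oplus>\<^bsub>F\<^esub> Q y = Q (x + y)"
proof -
  obtain u where u: "u \<in> carrier (TF dot I1)" "Q x = Q (tensor_lift u)"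
    using tensor_lift_onto[of x] by (auto simp: free_class_eq_iff intro: cong_sym)
  obtain w where w: "w \<in> carrier (TF dot I1)" "Q y = Q (tensor_lift w)"
    using tensor_lift_onto[of y] by (auto simp: free_class_eq_iff intro: cong_sym)
  interpret normal "TR dot I1" "TF dot I1"
    by (rule comm_group.subgroup_imp_normal[OF comm_group_TF subgroup_TR])
  have "Q x \<oplus>\<^bsub>F\<^esub> Q y = Q (tensor_lift (u + w))"
    using rcos_sum[of u w] u w TF_add[of u dot I1 w]
    by (simp add: half_cqg_t_def base_change_def Let_def FactGroup_def
        flip: tensor_class_eq, simp add: tensor_class_def)
  also have "\<dots> = Q (x + y)"
    using u w by (simp add: tensor_lift_add free_class_eq_iff cong_add cong_sym)
  finally show ?thesis .
qed

lemma half_cqg_t_zero: "\<zero>\<^bsub>F\<^esub> = Q 0"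
proof -
  have "TR dot I1 = Q 0"
    by (auto simp: tensor_rels_iff free_class_def cong_0_iff)
  then show ?thesis
    by (simp add: half_cqg_t_def base_change_def Let_def FactGroup_def)
qed

lemma half_cqg_t_one: "\<one>\<^bsub>F\<^esub> = Q 1"
  using pure_tensor_eq[of 1 1]
  by (simp add: half_cqg_t_def base_change_def Let_def half_cqg_one free_t_scalar_1 free_incl_1)

lemma tensor_lift_scale:
  fixes c :: Qvt_pi
  assumes "u \<in> carrier (TF dot I1)"
  defines "w \<equiv> frag_extend (\<lambda>(b, x). frag_of (c * b, x)) u"
  shows "w \<in> carrier (TF dot I1) \<and> serre_cong dot I1 (tensor_lift w) (free_t_scalar c * tensor_lift u)"
  using assms(1) unfolding w_def
proof (induction rule: TF_induct)
  case (of b x)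
  have "serre_cong dot I1 (tensor_lift (frag_of (c * b, hc x))) (free_t_scalar (c * b) * free_incl x)"
    by (rule tensor_lift_of)
  also have "serre_cong dot I1 (free_t_scalar (c * b) * free_incl x)
      (free_t_scalar c * tensor_lift (frag_of (b, hc x)))"
    unfolding free_t_scalar_mult mult.assoc
    by (intro cong_mult cong_refl cong_sym[OF tensor_lift_of])
  finally show ?case by simp
qed (auto simp: tensor_lift_0 frag_extend_diff tensor_lift_diff right_diff_distrib intro: TF_diff cong_diff)

lemma half_cqg_t_smult: "c \<odot>\<^bsub>F\<^esub> Q x = Q (free_t_scalar c * x)"
proof -
  have "tensor_class scalar_incl (half_cqg dot I1) (frag_extend (\<lambda>(b, x). frag_of (c * b, x)) u) =
      Q (free_t_scalar c * x)" if "u \<in> Q x" for u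
  proof -
    have "u \<in> carrier (TF dot I1)" and u: "serre_cong dot I1 (tensor_lift u) x"
      using that by (auto simp: free_class_def)
    then have "frag_extend (\<lambda>(b, x). frag_of (c * b, x)) u \<in> carrier (TF dot I1)"
      "serre_cong dot I1 (tensor_lift (frag_extend (\<lambda>(b, x). frag_of (c * b, x)) u)) (free_t_scalar c * tensor_lift u)"
      using tensor_lift_scale by blast+
    moreover have "serre_cong dot I1 (free_t_scalar c * tensor_lift u) (free_t_scalar c * x)"
      by (rule cong_mult[OF cong_refl u])
    ultimately show ?thesis
      by (simp add: tensor_class_eq free_class_eq_iff) (rule cong_trans)
  qed
  then show ?thesis
    using free_class_nonempty[of x] SUP_eq_const[of "Q x"]
    by (simp add: half_cqg_t_def base_change_def Let_def) auto
qed

private abbreviation (input) "frag_mult u w \<equiv>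
  frag_extend (\<lambda>(b, x). frag_extend (\<lambda>(c, y). frag_of (b * c, x \<otimes>\<^bsub>half_cqg dot I1\<^esub> y)) w) u"

text \<open>The product of representatives is a bilinear expression in formal sums, so it is enough to compare
both sides on pairs \<open>(b, [x])\<close> and \<open>(c, [y])\<close>.\<close>

lemma tensor_lift_mult:
  assumes u: "u \<in> carrier (TF dot I1)" and w: "w \<in> carrier (TF dot I1)"
  shows "frag_mult u w \<in> carrier (TF dot I1) \<and>
    serre_cong dot I1 (tensor_lift (frag_mult u w)) (tensor_lift u * tensor_lift w)"
  using u
proof (induction rule: TF_induct)
  case (of b x)
  show ?case
    using w
  proof (induction rule: TF_induct)
    case (of c y)
    have "serre_cong dot I1 (tensor_lift (frag_of (b * c, hc (x * y)))) (free_t_scalar (b * c) * free_incl (x * y))"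
      by (rule tensor_lift_of)
    also have "free_t_scalar (b * c) * free_incl (x * y) =
        (free_t_scalar b * free_incl x) * (free_t_scalar c * free_incl y)"
      using free_t_scalar_central[of "free_incl x" c]
      by (simp add: free_t_scalar_mult free_incl_mult mult.assoc)
         (simp flip: mult.assoc)
    also have "serre_cong dot I1 \<dots> (tensor_lift (frag_of (b, hc x)) * tensor_lift (frag_of (c, hc y)))"
      by (intro cong_mult cong_sym[OF tensor_lift_of])
    finally show ?case by (simp add: half_cqg_mult)
  qed (auto simp: tensor_lift_0 frag_extend_diff tensor_lift_diff right_diff_distrib intro: TF_diff cong_diff)
qed (auto simp: tensor_lift_0 frag_extend_diff tensor_lift_diff left_diff_distrib intro: TF_diff cong_diff)

text \<open>The product in the tensor product is a union over all representatives; all members of that union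
coincide because the Serre ideal is two-sided.\<close>

lemma half_cqg_t_mult: "Q x \<otimes>\<^bsub>F\<^esub> Q y = Q (x * y)"
proof -
  have "tensor_class scalar_incl (half_cqg dot I1) (frag_mult u w) = Q (x * y)"
    if "u \<in> Q x" "w \<in> Q y" for u w
  proof -
    have uw: "serre_cong dot I1 (tensor_lift u) x" "serre_cong dot I1 (tensor_lift w) y"
      using that by (auto simp: free_class_def)
    have "frag_mult u w \<in> carrier (TF dot I1)"
      "serre_cong dot I1 (tensor_lift (frag_mult u w)) (tensor_lift u * tensor_lift w)"
      using tensor_lift_mult[of u w] that by (auto simp: free_class_def)
    moreover have "serre_cong dot I1 (tensor_lift u * tensor_lift w) (x * y)"
      by (rule cong_mult[OF uw])
    ultimately show ?thesis
      by (simp add: tensor_class_eq free_class_eq_iff) (rule cong_trans)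
  qed
  then show ?thesis
    using free_class_nonempty[of x] free_class_nonempty[of y]
    by (auto simp: half_cqg_t_def base_change_def Let_def)
qed

lemma theta_eq: "theta dot I1 i = Q (Poly_Mapping.single (FWord [i]) 1)"
  by (simp add: theta_def pure_tensor_eq free_t_scalar_1 free_gen_def free_incl_single incl.one)

definition homogeneous :: "('i \<Rightarrow> int) \<Rightarrow> 'i free_t set" where
  "homogeneous \<nu> = {x. Poly_Mapping.keys x \<subseteq> {w. weight w = \<nu>}}"

text \<open>The homogeneous components of \<open>f[t]\<close> are generated as groups, so homogeneous lifts are built along this
generation, the inverse of the class of \<open>x\<close> being the class of \<open>-x\<close>.\<close>

lemma half_t_graded_obtain:
  assumes "K \<in> half_t_graded dot I1 \<nu>"
  obtains x where "x \<in> homogeneous \<nu>" "K = Q x"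
proof -
  let ?H = "{pure_tensor scalar_incl (half_cqg dot I1) c x | c x. x \<in> half_graded dot I1 \<nu>}"
  have H: "\<exists>x\<in>homogeneous \<nu>. K = Q x" if KH: "K \<in> ?H" for K
  proof -
    obtain c x where K: "K = pure_tensor scalar_incl (half_cqg dot I1) c (hc x)"
      and x: "\<forall>w\<in>Poly_Mapping.keys x. weight w = \<nu>"
      using KH unfolding half_graded_def by blast
    have "Poly_Mapping.keys (free_t_scalar c * free_incl x) \<subseteq> Poly_Mapping.keys x"
      using keys_mult[of "free_t_scalar c" "free_incl x"] keys_mapp_subset[of "\<lambda>_. scalar_incl" x]
      by (auto simp: free_t_scalar_def free_incl_def split: if_splits)
    with x show ?thesis
      by (intro bexI[of _ "free_t_scalar c * free_incl x"]) (auto simp: K pure_tensor_eq homogeneous_def)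
  qed
  have "\<exists>x\<in>homogeneous \<nu>. K = Q x"
    using assms unfolding half_t_graded_def
  proof (induction rule: generate.induct)
    case one
    then show ?case
      by (intro bexI[of _ 0]) (auto simp: half_cqg_t_zero homogeneous_def)
  next
    case (incl h)
    then show ?case by (rule H)
  next
    case (inv h)
    then obtain x where x: "x \<in> homogeneous \<nu>" "h = Q x"
      using H by blast
    have "inv\<^bsub>add_monoid F\<^esub> Q x = Q (- x)"
      unfolding m_inv_def
    proof (rule the_equality)
      fix K assume "K \<in> carrier (add_monoid F) \<and>
        Q x \<otimes>\<^bsub>add_monoid F\<^esub> K = \<one>\<^bsub>add_monoid F\<^esub> \<and> K \<otimes>\<^bsub>add_monoid F\<^esub> Q x = \<one>\<^bsub>add_monoid F\<^esub>"
      then obtain y where "K = Q y" "Q (x + y) = Q 0"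
        by (auto simp: half_cqg_t_carrier half_cqg_t_zero half_cqg_t_add)
      then show "K = Q (- x)"
        by (simp add: free_class_eq_iff serre_cong_def add.commute)
    qed (simp add: half_cqg_t_carrier half_cqg_t_zero half_cqg_t_add)
    with x show ?case
      by (intro bexI[of _ "- x"]) (auto simp: homogeneous_def)
  next
    case (eng h1 h2)
    then obtain x y where "x \<in> homogeneous \<nu>" "h1 = Q x" "y \<in> homogeneous \<nu>" "h2 = Q y"
      by blast
    then show ?case
      using keys_add[of x y]
      by (intro bexI[of _ "x + y"]) (auto simp: half_cqg_t_add homogeneous_def)
  qed
  then show ?thesis using that by blast
qed

lemma free_class_single_graded: "Q (Poly_Mapping.single w c) \<in> half_t_graded dot I1 (weight w)"
proof -
  have "hc (Poly_Mapping.single w 1) \<in> half_graded dot I1 (weight w)"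
    by (auto simp: half_graded_def)
  then have "pure_tensor scalar_incl (half_cqg dot I1) c (hc (Poly_Mapping.single w 1)) \<in> half_t_graded dot I1 (weight w)"
    unfolding half_t_graded_def by (intro generate.incl) blast
  then show ?thesis
    by (simp add: pure_tensor_eq free_t_scalar_def free_incl_single incl.one mult_single)
qed

end

section \<open>Weights and the quantum Serre elements\<close>

lemma letters_0: "letters 0 = []"
  by (simp add: zero_fword_def)

lemma weight_add: "weight (u + w) = (\<lambda>i. weight u i + weight w i)"
  by (auto simp: weight_def plus_fword_def)

lemma weight_Nil: "weight (FWord []) = (\<lambda>_. 0)"
  by (auto simp: weight_def)

lemma weight_Cons: "weight (FWord (i # l)) = (\<lambda>k. (if k = i then 1 else 0) + weight (FWord l) k)"
  by (auto simp: weight_def fun_eq_iff)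

lemma homogeneous_single: "Poly_Mapping.single w c \<in> homogeneous (weight w)"
  by (simp add: homogeneous_def)

lemma homogeneous_mult:
  "x \<in> homogeneous \<mu> \<Longrightarrow> y \<in> homogeneous \<nu> \<Longrightarrow> x * y \<in> homogeneous (\<lambda>i. \<mu> i + \<nu> i)"
proof -
  assume x: "x \<in> homogeneous \<mu>" and y: "y \<in> homogeneous \<nu>"
  have "weight w = (\<lambda>i. \<mu> i + \<nu> i)" if w: "w \<in> Poly_Mapping.keys (x * y)" for w
  proof -
    obtain a b where "w = a + b" "a \<in> Poly_Mapping.keys x" "b \<in> Poly_Mapping.keys y"
      using keys_mult[of x y] w by blast
    then show ?thesis
      using x y by (auto simp: homogeneous_def weight_add)
  qed
  then show ?thesis by (auto simp: homogeneous_def)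
qed

lemma homogeneous_induct [consumes 1, case_names zero add_single]:
  assumes "x \<in> homogeneous \<nu>" "P 0"
    "\<And>x w c. P x \<Longrightarrow> weight w = \<nu> \<Longrightarrow> P (x + Poly_Mapping.single w c)"
  shows "P x"
  by (rule poly_mapping_keys_induct[where S="{w. weight w = \<nu>}"])
     (use assms in \<open>auto simp: homogeneous_def\<close>)

lemma free_gen_power: "free_gen i ^ n = Poly_Mapping.single (FWord (replicate n i)) 1"
  by (induction n) (simp_all add: free_gen_def mult_single plus_fword_def flip: zero_fword_def)

text \<open>The \<open>k\<close>-th word \<open>i\<^sup>b\<^sup>-\<^sup>k j i\<^sup>k\<close> of a Serre element.\<close>

definition serre_word :: "nat \<Rightarrow> 'i \<Rightarrow> 'i \<Rightarrow> nat \<Rightarrow> 'i list" where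
  "serre_word b i j k = replicate (b - k) i @ j # replicate k i"

lemma weight_replicate: "weight (FWord (replicate n i)) = (\<lambda>l. if l = i then int n else 0)"
  by (induction n) (auto simp: weight_Nil weight_Cons fun_eq_iff)

lemma weight_serre_word:
  assumes "k \<le> b"
  shows "weight (FWord (serre_word b i j k)) = (\<lambda>l. (if l = i then int b else 0) + (if l = j then 1 else 0))"
proof -
  have "FWord (serre_word b i j k) = FWord (replicate (b - k) i) + FWord (j # replicate k i)"
    by (simp add: serre_word_def plus_fword_def)
  then show ?thesis
    using assms by (auto simp: weight_add weight_Cons weight_replicate fun_eq_iff)
qed

lemma homogeneous_sum:
  "(\<And>k. k \<in> S \<Longrightarrow> g k \<in> homogeneous \<nu>) \<Longrightarrow> sum g S \<in> homogeneous \<nu>"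
  using keys_sum[of g S] unfolding homogeneous_def by blast

lemma scalar_incl_v: "scalar_incl cov_v = cov_v"
proof -
  have "ratfun_incl (Fract [:0, 1:] 1) = Fract [:0, 1:] 1"
    by (simp add: ratfun_incl_Fract map_poly_pCons)
  then show ?thesis
    using ring_embedding.zero[OF ring_embedding_ratfun_incl] by (simp add: cov_v_def)
qed

lemma scalar_incl_pi: "scalar_incl cov_pi = cov_pi"
  using ring_embedding.zero[OF ring_embedding_ratfun_incl] ring_embedding.one[OF ring_embedding_ratfun_incl]
  by (simp add: cov_pi_def)

context
  fixes dot :: "'i \<Rightarrow> 'i \<Rightarrow> int" and I1 :: "'i set"
begin

definition serre_coeff :: "'i \<Rightarrow> 'i \<Rightarrow> nat \<Rightarrow> Qvt_pi" where
  "serre_coeff i j k = (-1) ^ k * cov_pi ^ ((k choose 2) * cd_p I1 i + k * cd_p I1 i * cd_p I1 j)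
     * qbinom (cov_v powi cd_d dot i) (cov_pi powi cd_d dot i) (int (nat (1 - cd_a dot i j))) k"

lemma free_incl_serre:
  "free_incl (serre dot I1 i j) =
    (\<Sum>k\<le>nat (1 - cd_a dot i j). Poly_Mapping.single (FWord (serre_word (nat (1 - cd_a dot i j)) i j k)) (serre_coeff i j k))"
proof -
  have s: "free_incl (sum g S) = (\<Sum>k\<in>S. free_incl (g k))" for g :: "nat \<Rightarrow> 'i free_alg" and S
    by (induction S rule: infinite_finite_induct) (simp_all add: free_incl_0 free_incl_add)
  show ?thesis
    unfolding serre_def Let_def s
    by (intro sum.cong refl, unfold free_gen_power)
       (simp add: free_scalar_def free_gen_def mult_single free_incl_single plus_fword_def serre_word_def
        zero_fword_def serre_coeff_def incl.mult incl.power incl.qbinom incl.power_int incl.uminus incl.one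
        scalar_incl_v scalar_incl_pi)
qed

text \<open>All words \<open>i\<^sup>b\<^sup>-\<^sup>k j i\<^sup>k\<close> have weight \<open>b i + j\<close>; the twist can therefore be pulled through products with
a Serre element.\<close>

lemma homogeneous_serre: "\<exists>\<nu>. free_incl (serre dot I1 i j) \<in> homogeneous \<nu>"
proof -
  let ?b = "nat (1 - cd_a dot i j)"
  have "free_incl (serre dot I1 i j) \<in> homogeneous (\<lambda>l. (if l = i then int ?b else 0) + (if l = j then 1 else 0))"
    unfolding free_incl_serre
  proof (rule homogeneous_sum)
    fix k assume "k \<in> {..?b}"
    then show "Poly_Mapping.single (FWord (serre_word ?b i j k)) (serre_coeff i j k)
        \<in> homogeneous (\<lambda>l. (if l = i then int ?b else 0) + (if l = j then 1 else 0))"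
      using homogeneous_single[of "FWord (serre_word ?b i j k)" "serre_coeff i j k"]
      by (simp add: weight_serre_word)
  qed
  then show ?thesis by blast
qed

end

section \<open>The twist of the free algebra\<close>

context
  fixes dot :: "'i::{finite,linorder} \<Rightarrow> 'i \<Rightarrow> int" and I1 :: "'i set"
begin

lemma phi_add_left: "phi dot I1 (\<lambda>i. \<mu> i + \<mu>' i) \<nu> = phi dot I1 \<mu> \<nu> + phi dot I1 \<mu>' \<nu>"
  by (simp add: phi_def distrib_right sum.distrib)

lemma phi_add_right: "phi dot I1 \<mu> (\<lambda>i. \<nu> i + \<nu>' i) = phi dot I1 \<mu> \<nu> + phi dot I1 \<mu> \<nu>'"
  by (simp add: phi_def distrib_left distrib_right sum.distrib)

lemma phi_unit: "phi dot I1 (\<lambda>k. if k = i then 1 else 0) (\<lambda>k. if k = j then 1 else 0) = phi_basis dot I1 i j"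
proof -
  have "phi dot I1 (\<lambda>k. if k = i then 1 else 0) (\<lambda>k. if k = j then 1 else 0) =
    (\<Sum>a\<in>UNIV. \<Sum>b\<in>UNIV. if a = i then if b = j then phi_basis dot I1 a b else 0 else 0)"
    unfolding phi_def by (intro sum.cong) auto
  also have "\<dots> = (\<Sum>a\<in>UNIV. if a = i then phi_basis dot I1 a j else 0)"
    by (intro sum.cong) (auto simp: sum.delta)
  finally show ?thesis by simp
qed

lemma phi_zero: "phi dot I1 (\<lambda>_. 0) \<nu> = 0" "phi dot I1 \<mu> (\<lambda>_. 0) = 0"
  by (simp_all add: phi_def)

lemma phi_weight:
  "phi dot I1 (weight (FWord u)) (weight (FWord w)) = (\<Sum>i\<leftarrow>u. \<Sum>j\<leftarrow>w. phi_basis dot I1 i j)"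
proof (induction u)
  case (Cons i u)
  have "phi dot I1 (\<lambda>k. if k = i then 1 else 0) (weight (FWord w)) = (\<Sum>j\<leftarrow>w. phi_basis dot I1 i j)"
    by (induction w) (simp_all add: weight_Nil phi_zero weight_Cons phi_add_right phi_unit)
  with Cons show ?case
    by (simp add: weight_Cons phi_add_left)
qed (simp add: weight_Nil phi_zero)

text \<open>The sum of \<open>\<phi>\<close> over all ordered pairs of positions in a word: a quadratic function whose polarisation is
\<open>\<phi>\<close> (see \<open>word_exp_add\<close>).\<close>

fun word_exp :: "'i list \<Rightarrow> int" where
  "word_exp [] = 0"
| "word_exp (i # w) = (\<Sum>j\<leftarrow>w. phi_basis dot I1 i j) + word_exp w"

lemma word_exp_append:
  "word_exp (u @ w) = word_exp u + word_exp w + (\<Sum>i\<leftarrow>u. \<Sum>j\<leftarrow>w. phi_basis dot I1 i j)"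
  by (induction u) simp_all

lemma word_exp_add:
  "word_exp (letters (u + w)) = word_exp (letters u) + word_exp (letters w) + phi dot I1 (weight u) (weight w)"
  by (cases u; cases w) (simp add: plus_fword_def word_exp_append phi_weight)

lemma word_exp_replicate: "word_exp (replicate n i) = phi_basis dot I1 i i * int (n choose 2)"
proof (induction n)
  case (Suc n)
  have "Suc n choose 2 = n + (n choose 2)"
    using binomial_Suc_Suc[of n 1] by (simp only: Suc_1 choose_one One_nat_def[symmetric])
  with Suc show ?case
    by (simp add: sum_list_replicate distrib_left)
qed simp

definition twist :: "'i free_t \<Rightarrow> 'i free_t" where
  "twist = Poly_Mapping.mapp (\<lambda>w c. tpow (word_exp (letters w)) * sig c)"

text \<open>The inverse of \<^const>\<open>twist\<close>; the power of \<open>t\<close> has to be removed before \<open>\<sigma>\<^sup>-\<^sup>1\<close> is applied.\<close>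

definition untwist :: "'i free_t \<Rightarrow> 'i free_t" where
  "untwist = Poly_Mapping.mapp (\<lambda>w c. sig_inv (tpow (- word_exp (letters w)) * c))"

lemma twist_single: "twist (Poly_Mapping.single w c) = Poly_Mapping.single w (tpow (word_exp (letters w)) * sig c)"
  by (simp add: twist_def mapp_single sig.zero)

lemma twist_add: "twist (x + y) = twist x + twist y"
  by (simp add: twist_def mapp_add sig.zero sig.add distrib_left)

lemma untwist_add: "untwist (x + y) = untwist x + untwist y"
  by (simp add: untwist_def mapp_add sig_inv.zero sig_inv.add distrib_left)

lemma twist_0: "twist 0 = 0"
  using twist_add[of 0 0] by simp

lemma untwist_0: "untwist 0 = 0"
  using untwist_add[of 0 0] by simp

lemma twist_diff: "twist (x - y) = twist x - twist y"
  using twist_add[of "x - y" y] by simp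

lemma untwist_diff: "untwist (x - y) = untwist x - untwist y"
  using untwist_add[of "x - y" y] by simp

lemma twist_sum: "twist (sum g S) = (\<Sum>k\<in>S. twist (g k))"
  by (induction S rule: infinite_finite_induct) (simp_all add: twist_0 twist_add)

lemma lookup_twist:
  "Poly_Mapping.lookup (twist x) w = tpow (word_exp (letters w)) * sig (Poly_Mapping.lookup x w)"
  unfolding twist_def by (rule lookup_mapp_zero) (simp add: sig.zero)

lemma lookup_untwist:
  "Poly_Mapping.lookup (untwist x) w = sig_inv (tpow (- word_exp (letters w)) * Poly_Mapping.lookup x w)"
  unfolding untwist_def by (rule lookup_mapp_zero) (simp add: sig_inv.zero)

lemma twist_untwist: "twist (untwist x) = x"
  by (rule poly_mapping_eqI) (simp add: lookup_twist lookup_untwist sig_sig_inv tpow_minus_cancel)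

lemma untwist_twist: "untwist (twist x) = x"
  by (rule poly_mapping_eqI) (simp add: lookup_twist lookup_untwist sig_inv_sig tpow_minus_cancel)

lemma homogeneous_untwist: "x \<in> homogeneous \<nu> \<Longrightarrow> untwist x \<in> homogeneous \<nu>"
  by (auto simp: homogeneous_def untwist_def dest: subsetD[OF keys_mapp_subset])

lemma twist_scalar: "twist (free_t_scalar c * x) = free_t_scalar (sig c) * twist x"
proof (induction x rule: poly_mapping_add_induct)
  case zero
  then show ?case by (simp add: twist_0)
next
  case (add_single x w d)
  have "twist (free_t_scalar c * Poly_Mapping.single w d) = free_t_scalar (sig c) * twist (Poly_Mapping.single w d)"
    unfolding free_t_scalar_def mult_single twist_single sig.mult add_0_left
    by (simp only: mult.left_commute)
  with add_single show ?case
    by (simp add: distrib_left twist_add)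
qed

lemma untwist_scalar: "untwist (free_t_scalar c * x) = free_t_scalar (sig_inv c) * untwist x"
  using arg_cong[OF twist_scalar[of "sig_inv c" "untwist x"], of untwist]
  by (simp add: untwist_twist twist_untwist sig_sig_inv)

lemma twist_1: "twist 1 = 1"
  using twist_single[of 0 1] by (simp add: sig.one tpow_0 letters_0)

text \<open>On words this is \<open>word_exp_add\<close>; it extends additively because \<open>\<phi>\<close> depends only on the weights, which are
constant on homogeneous elements.\<close>

lemma twist_mult:
  assumes "x \<in> homogeneous \<mu>" "y \<in> homogeneous \<nu>"
  shows "twist (x * y) = free_t_scalar (tpow (phi dot I1 \<mu> \<nu>)) * (twist x * twist y)"
  using assms(1)
proof (induction x rule: homogeneous_induct)
  case zero
  then show ?case by (simp add: twist_0)
next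
  case (add_single x u c)
  have "twist (Poly_Mapping.single u c * y) =
      free_t_scalar (tpow (phi dot I1 \<mu> \<nu>)) * (twist (Poly_Mapping.single u c) * twist y)"
    using assms(2)
  proof (induction y rule: homogeneous_induct)
    case zero
    then show ?case by (simp add: twist_0)
  next
    case (add_single y w d)
    have "twist (Poly_Mapping.single u c * Poly_Mapping.single w d) =
        free_t_scalar (tpow (phi dot I1 \<mu> \<nu>)) * (twist (Poly_Mapping.single u c) * twist (Poly_Mapping.single w d))"
      using \<open>weight u = \<mu>\<close> \<open>weight w = \<nu>\<close>
      by (simp add: mult_single twist_single free_t_scalar_def word_exp_add tpow_add sig.mult mult_ac)
    with add_single show ?case
      by (simp add: distrib_left twist_add)
  qed
  with add_single show ?case
    by (simp add: distrib_left distrib_right twist_add)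
qed

lemma twist_untwist_mult:
  assumes "x \<in> homogeneous \<mu>" "y \<in> homogeneous \<nu>"
  shows "twist (untwist x * untwist y) = free_t_scalar (tpow (phi dot I1 \<mu> \<nu>)) * (x * y)"
  using twist_mult[OF assms[THEN homogeneous_untwist]] by (simp add: twist_untwist)

text \<open>Obtained from \<open>twist_untwist_mult\<close> by applying \<open>untwist\<close>. The scalar factor is left unspecified because the
statement serves to show membership in an ideal.\<close>

lemma untwist_mult:
  assumes "x \<in> homogeneous \<mu>" "y \<in> homogeneous \<nu>"
  shows "\<exists>c. untwist (x * y) = free_t_scalar c * (untwist x * untwist y)"
proof -
  let ?\<phi> = "phi dot I1 \<mu> \<nu>"
  have "untwist x * untwist y = free_t_scalar (sig_inv (tpow ?\<phi>)) * untwist (x * y)"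
    using arg_cong[OF twist_untwist_mult[OF assms], of untwist] by (simp add: untwist_twist untwist_scalar)
  moreover have "sig_inv (tpow (- ?\<phi>)) * sig_inv (tpow ?\<phi>) = 1"
    using tpow_minus_cancel(2)[of ?\<phi> 1] by (simp add: sig_inv.one flip: sig_inv.mult)
  ultimately have "untwist (x * y) = free_t_scalar (sig_inv (tpow (- ?\<phi>))) * (untwist x * untwist y)"
    by (simp only: mult.assoc[symmetric] free_t_scalar_mult[symmetric] free_t_scalar_1 mult_1_left)
  then show ?thesis ..
qed

end

section \<open>The Serre elements are eigenvectors of the twist\<close>

lemma int_choose_2: "2 * int (k choose 2) = int k * (int k - 1)"
proof (induction k)
  case (Suc k)
  have "Suc k choose 2 = k + (k choose 2)"
    using binomial_Suc_Suc[of k 1] by (simp only: Suc_1 choose_one One_nat_def[symmetric])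
  with Suc show ?case by (simp add: algebra_simps)
qed simp

text \<open>The pairs of letters \<open>i\<close> contribute \<open>\<phi>(i,i)\<close> each, whatever the position of \<open>j\<close>; each of the \<open>b - k\<close> letters
before \<open>j\<close> contributes \<open>\<phi>(i,j)\<close> and each of the \<open>k\<close> letters after it \<open>\<phi>(j,i)\<close>. Hence only the last summand
depends on \<open>k\<close>.\<close>

lemma word_exp_serre_word:
  assumes "k \<le> b"
  shows "word_exp dot I1 (serre_word b i j k) =
    phi_basis dot I1 i i * int (b choose 2) + int b * phi_basis dot I1 i j +
    int k * (phi_basis dot I1 j i - phi_basis dot I1 i j)"
proof -
  have bk: "int (b - k) = int b - int k" using assms by simp
  have "2 * (int ((b - k) choose 2) + int (k choose 2) + int k * (int b - int k)) = 2 * int (b choose 2)"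
    unfolding distrib_left int_choose_2 bk by (simp add: algebra_simps)
  then have c: "int (b choose 2) = int ((b - k) choose 2) + int (k choose 2) + int k * (int b - int k)"
    by simp
  show ?thesis
    unfolding c
    by (simp add: serre_word_def word_exp_append word_exp_replicate sum_list_replicate bk algebra_simps
        del: of_nat_diff)
qed

context super_cartan_datum
begin

lemma d_a: "i \<noteq> j \<Longrightarrow> cd_d dot i * cd_a dot i j = dot i j"
proof -
  assume "i \<noteq> j"
  then have "dot i i * cd_a dot i j = 2 * dot i j"
    using a_integral[of i j] by (simp add: cd_a_def)
  moreover have "dot i i = 2 * cd_d dot i"
    using d_integral[of i] by (simp add: cd_d_def)
  ultimately show ?thesis by simp
qed

text \<open>The arithmetic heart of the theorem. The three summands come from the word, from the sign
produced by \<open>\<pi> \<mapsto> -\<pi>\<close>, and from the binomial coefficient. With \<open>d\<^sub>i a\<^sub>i\<^sub>j = d\<^sub>j a\<^sub>j\<^sub>i = i \<cdot> j\<close> and \<open>k\<^sup>2 = k + 2q\<close>,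
\<open>q\<close> the binomial coefficient of \<open>k\<close> over \<open>2\<close>, the sum becomes the following. For even \<open>i\<close> it is \<open>-2 d\<^sub>i q\<close>,
together with \<open>-2 k d\<^sub>i a\<^sub>i\<^sub>j\<close> if \<open>j\<close> precedes \<open>i\<close>; here \<open>d\<^sub>i\<close> is even. For odd \<open>i\<close> it is \<open>-2 (d\<^sub>i - 1) q\<close>, together
with \<open>-2 k d\<^sub>i a\<^sub>i\<^sub>j\<close> if \<open>j\<close> precedes \<open>i\<close> and \<open>4 k p(j)\<close> otherwise; here \<open>d\<^sub>i - 1\<close> and \<open>a\<^sub>i\<^sub>j\<close> are even.\<close>

lemma serre_exponent:
  fixes ord :: "'i \<Rightarrow> 'i \<Rightarrow> bool"
  assumes "i \<noteq> j"
  defines "\<phi>ij \<equiv> (if ord j i then cd_d dot i * cd_a dot i j else - 2 * int (cd_p I1 i) * int (cd_p I1 j))"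
    and "\<phi>ji \<equiv> (if ord j i then - 2 * int (cd_p I1 j) * int (cd_p I1 i) else cd_d dot j * cd_a dot j i)"
  shows "\<exists>z. int k * (\<phi>ji - \<phi>ij) + 2 * int ((k choose 2) * cd_p I1 i + k * cd_p I1 i * cd_p I1 j)
    + cd_d dot i * int k * (1 - cd_a dot i j - int k) = 4 * z"
proof -
  let ?d = "cd_d dot i" and ?a = "cd_a dot i j" and ?K = "int k" and ?q = "int (k choose 2)"
  have sym: "cd_d dot j * cd_a dot j i = ?d * ?a"
    using d_a[of i j] d_a[of j i] assms(1) dot_sym by simp
  have K: "?K * ?K = ?K + 2 * ?q"
    using int_choose_2[of k] by (simp add: algebra_simps)
  have L: "?d * ?K * (1 - ?a - ?K) = - ?K * ?d * ?a - 2 * ?d * ?q"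
  proof -
    have "?d * ?K * (1 - ?a - ?K) = ?d * ?K - ?K * ?d * ?a - ?d * (?K * ?K)"
      by (simp add: algebra_simps)
    then show ?thesis unfolding K by (simp add: algebra_simps)
  qed
  show ?thesis
  proof (cases "i \<in> I1")
    case False
    then have p: "cd_p I1 i = 0" and "even ?d"
      using bar_consistent[of i] by (auto simp: cd_p_def)
    then obtain d' where d': "?d = 2 * d'" by blast
    show ?thesis
      unfolding L \<phi>ij_def \<phi>ji_def sym
      by (rule exI[of _ "if ord j i then - ?K * d' * ?a - d' * ?q else - d' * ?q"])
         (simp add: p d' algebra_simps)
  next
    case True
    then have p: "cd_p I1 i = 1" and odd: "odd ?d"
      using bar_consistent[of i] by (auto simp: cd_p_def odd_iff_mod_2_eq_one)
    then obtain d' where d': "?d = 2 * d' + 1" by (auto elim: oddE)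
    obtain a' where a': "?a = 2 * a'"
      using anisotropic_even[OF True, of j] by blast
    show ?thesis
      unfolding L \<phi>ij_def \<phi>ji_def sym
      by (rule exI[of _ "if ord j i then - ?K * ?d * a' - d' * ?q else ?K * int (cd_p I1 j) - d' * ?q"])
         (simp add: p d' a' algebra_simps)
  qed
qed

end

text \<open>The coefficient of the \<open>k\<close>-th word is multiplied by a power of \<open>t\<close> whose exponent does not depend on
\<open>k\<close> modulo \<open>4\<close>, so it may be computed at \<open>k = 0\<close>.\<close>

lemma twist_serre:
  fixes dot :: "'i::{finite,linorder} \<Rightarrow> 'i \<Rightarrow> int"
  assumes "super_cartan_datum dot I1" "i \<noteq> j"
  shows "\<exists>n. twist dot I1 (free_incl (serre dot I1 i j)) = free_t_scalar (tpow n) * free_incl (serre dot I1 i j)"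
proof -
  interpret super_cartan_datum dot I1 by (rule assms(1))
  let ?b = "nat (1 - cd_a dot i j)" and ?d = "cd_d dot i"
  let ?n = "phi_basis dot I1 i i * int (?b choose 2) + int ?b * phi_basis dot I1 i j"
  have b: "int ?b = 1 - cd_a dot i j"
    using a_nonpos[OF assms(2)] by simp
  have coeff: "tpow (word_exp dot I1 (serre_word ?b i j k)) * sig (serre_coeff dot I1 i j k) =
      tpow ?n * serre_coeff dot I1 i j k" if "k \<le> ?b" for k
  proof -
    define m where "m = (k choose 2) * cd_p I1 i + k * cd_p I1 i * cd_p I1 j"
    have "(-1) ^ m = tpow (2 * int m)"
      by (simp add: tpow_double)
    then have "sig (serre_coeff dot I1 i j k) =
        tpow (2 * int m) * tpow (?d * int k * (int ?b - int k)) * serre_coeff dot I1 i j k"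
      unfolding serre_coeff_def m_def[symmetric]
      by (simp add: sig.mult sig.power sig.uminus sig.one sig_pi sig_qbinom[OF d_pos] power_minus[of cov_pi m] mult_ac)
    moreover have pij: "phi_basis dot I1 i j = (if j < i then ?d * cd_a dot i j else - 2 * int (cd_p I1 i) * int (cd_p I1 j))"
      and pji: "phi_basis dot I1 j i = (if j < i then - 2 * int (cd_p I1 j) * int (cd_p I1 i) else cd_d dot j * cd_a dot j i)"
      using assms(2) by (auto simp: phi_basis_def)
    obtain z where z: "int k * (phi_basis dot I1 j i - phi_basis dot I1 i j) + 2 * int m
        + ?d * int k * (int ?b - int k) = 4 * z"
      using serre_exponent[OF assms(2), where ord="(<)" and k=k]
      unfolding m_def b pij pji by blast
    have "word_exp dot I1 (serre_word ?b i j k) + (2 * int m + ?d * int k * (int ?b - int k)) = ?n + 4 * z"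
      unfolding word_exp_serre_word[OF that] z[symmetric] by simp
    then have "tpow (word_exp dot I1 (serre_word ?b i j k)) * (tpow (2 * int m) * tpow (?d * int k * (int ?b - int k)))
        = tpow ?n"
      by (simp only: tpow_add[symmetric] tpow_add_4)
    ultimately show ?thesis
      by (simp only: mult.assoc[symmetric])
  qed
  have "twist dot I1 (free_incl (serre dot I1 i j)) = free_t_scalar (tpow ?n) * free_incl (serre dot I1 i j)"
    unfolding free_incl_serre twist_sum sum_distrib_left
    by (intro sum.cong refl) (simp add: twist_single coeff free_t_scalar_def mult_single)
  then show ?thesis ..
qed

section \<open>The twisted product\<close>

context
  fixes dot :: "'i::{finite,linorder} \<Rightarrow> 'i \<Rightarrow> int" and I1 :: "'i set"
  assumes datum: "super_cartan_datum dot I1"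
begin

private abbreviation (input) "J \<equiv> serre_span dot I1"
private abbreviation (input) "Ft \<equiv> half_cqg_t dot I1"
private abbreviation (input) "cl \<equiv> free_class dot I1"
private abbreviation (input) "tw \<equiv> twist dot I1"
private abbreviation (input) "utw \<equiv> untwist dot I1"

text \<open>A product \<open>u S w\<close> with a Serre element \<open>S\<close> goes to a scalar multiple of the product of the images, and the image of
\<open>S\<close> is a multiple of \<open>S\<close>.\<close>

lemma twist_serre_span: "x \<in> J \<Longrightarrow> tw x \<in> J"
proof (induction rule: serre_span.induct)
  case zero
  then show ?case by (simp add: twist_0 serre_span.zero)
next
  case (step x i j u c w d)
  let ?S = "free_incl (serre dot I1 i j)" and ?u = "Poly_Mapping.single u c" and ?w = "Poly_Mapping.single w d"
  obtain \<nu> where \<nu>: "?S \<in> homogeneous \<nu>"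
    using homogeneous_serre[of dot I1 i j] by blast
  have "?S \<in> J"
    using serre_span_gen[OF step.hyps(2), of 0 1 dot I1 0 1] by simp
  then have S: "tw ?S \<in> J"
    using twist_serre[OF datum step.hyps(2)] by (auto intro: serre_span_mult_left)
  have "tw (?u * ?S * ?w) \<in> J"
    unfolding twist_mult[OF homogeneous_mult[OF homogeneous_single \<nu>] homogeneous_single]
      twist_mult[OF homogeneous_single \<nu>]
    by (rule serre_span_mult_left[OF serre_span_mult_right[OF serre_span_mult_left[OF serre_span_mult_left[OF S]]]])
  with step.IH show ?case
    by (simp add: twist_add serre_span_add)
qed

lemma untwist_serre_span: "x \<in> J \<Longrightarrow> utw x \<in> J"
proof (induction rule: serre_span.induct)
  case zero
  then show ?case by (simp add: untwist_0 serre_span.zero)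
next
  case (step x i j u c w d)
  let ?S = "free_incl (serre dot I1 i j)" and ?u = "Poly_Mapping.single u c" and ?w = "Poly_Mapping.single w d"
  obtain \<nu> where \<nu>: "?S \<in> homogeneous \<nu>"
    using homogeneous_serre[of dot I1 i j] by blast
  have "?S \<in> J"
    using serre_span_gen[OF step.hyps(2), of 0 1 dot I1 0 1] by simp
  moreover obtain n where n: "tw ?S = free_t_scalar (tpow n) * ?S"
    using twist_serre[OF datum step.hyps(2)] by blast
  have "tw (free_t_scalar (sig_inv (tpow (- n))) * ?S) = ?S"
    unfolding twist_scalar n sig_sig_inv
    by (simp add: free_t_scalar_1 tpow_unit flip: mult.assoc free_t_scalar_mult)
  then have "utw ?S = free_t_scalar (sig_inv (tpow (- n))) * ?S"
    by (metis untwist_twist)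
  ultimately have S: "utw ?S \<in> J"
    by (simp add: serre_span_mult_left)
  obtain a b where "utw (?u * ?S * ?w) = free_t_scalar a * (utw (?u * ?S) * utw ?w)"
    "utw (?u * ?S) = free_t_scalar b * (utw ?u * utw ?S)"
    using untwist_mult[OF homogeneous_mult[OF homogeneous_single \<nu>] homogeneous_single]
      untwist_mult[OF homogeneous_single \<nu>] by metis
  with S have "utw (?u * ?S * ?w) \<in> J"
    by (simp add: serre_span_mult_left serre_span_mult_right)
  with step.IH show ?case
    by (simp add: untwist_add serre_span_add)
qed

text \<open>The isomorphism \<open>\<Psi>\<close>.\<close>

definition class_twist :: "'i half_t \<Rightarrow> 'i half_t" where
  "class_twist K = cl (tw (SOME x. K = cl x))"

definition class_untwist :: "'i half_t \<Rightarrow> 'i half_t" where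
  "class_untwist K = cl (utw (SOME x. K = cl x))"

lemma class_twist: "class_twist (cl x) = cl (tw x)"
proof -
  have "cl x = cl (SOME y. cl x = cl y)"
    by (rule someI[of _ x]) (rule refl)
  then have "x - (SOME y. cl x = cl y) \<in> J"
    by (simp only: free_class_eq_iff serre_cong_def)
  then have "cl (tw x) = cl (tw (SOME y. cl x = cl y))"
    unfolding free_class_eq_iff serre_cong_def twist_diff[symmetric] by (rule twist_serre_span)
  then show ?thesis
    by (simp only: class_twist_def)
qed

lemma class_untwist: "class_untwist (cl x) = cl (utw x)"
proof -
  have "cl x = cl (SOME y. cl x = cl y)"
    by (rule someI[of _ x]) (rule refl)
  then have "x - (SOME y. cl x = cl y) \<in> J"
    by (simp only: free_class_eq_iff serre_cong_def)
  then have "cl (utw x) = cl (utw (SOME y. cl x = cl y))"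
    unfolding free_class_eq_iff serre_cong_def untwist_diff[symmetric] by (rule untwist_serre_span)
  then show ?thesis
    by (simp only: class_untwist_def)
qed

text \<open>The product on \<open>f[t]\<close> for which \<open>\<Psi>\<close> is multiplicative.\<close>

definition transported_mult :: "'i half_t \<Rightarrow> 'i half_t \<Rightarrow> 'i half_t" where
  "transported_mult K L = (if K \<in> carrier Ft \<and> L \<in> carrier Ft
     then class_twist (class_untwist K \<otimes>\<^bsub>Ft\<^esub> class_untwist L) else undefined)"

lemma transported_mult: "transported_mult (cl x) (cl y) = cl (tw (utw x * utw y))"
  by (simp add: transported_mult_def half_cqg_t_carrier class_untwist half_cqg_t_mult class_twist)

lemma is_twisted_product_transported: "is_twisted_product dot I1 transported_mult"
  unfolding is_twisted_product_def Let_def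
proof (intro conjI)
  show "\<forall>K\<in>carrier Ft. \<forall>L\<in>carrier Ft. transported_mult K L \<in> carrier Ft"
    by (auto simp: half_cqg_t_carrier transported_mult)
  show "\<forall>K\<in>carrier Ft. \<forall>L\<in>carrier Ft. \<forall>M\<in>carrier Ft.
      transported_mult (K \<oplus>\<^bsub>Ft\<^esub> L) M = transported_mult K M \<oplus>\<^bsub>Ft\<^esub> transported_mult L M \<and>
      transported_mult M (K \<oplus>\<^bsub>Ft\<^esub> L) = transported_mult M K \<oplus>\<^bsub>Ft\<^esub> transported_mult M L"
    unfolding half_cqg_t_carrier
    by (clarsimp simp: transported_mult half_cqg_t_add untwist_add twist_add distrib_left distrib_right)
  have "untwist dot I1 x * (free_t_scalar d * untwist dot I1 y) = free_t_scalar d * (untwist dot I1 x * untwist dot I1 y)"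
    for x y d
    using free_t_scalar_central[of "untwist dot I1 x" d] by (simp flip: mult.assoc)
  then show "\<forall>c. \<forall>K\<in>carrier Ft. \<forall>L\<in>carrier Ft.
      transported_mult (c \<odot>\<^bsub>Ft\<^esub> K) L = c \<odot>\<^bsub>Ft\<^esub> transported_mult K L \<and>
      transported_mult K (c \<odot>\<^bsub>Ft\<^esub> L) = c \<odot>\<^bsub>Ft\<^esub> transported_mult K L"
    unfolding half_cqg_t_carrier
    by (clarsimp simp: transported_mult half_cqg_t_smult untwist_scalar twist_scalar mult.assoc sig_sig_inv)
  show "\<forall>\<mu> \<nu>. \<forall>K\<in>half_t_graded dot I1 \<mu>. \<forall>L\<in>half_t_graded dot I1 \<nu>.
      transported_mult K L = cov_t powi phi dot I1 \<mu> \<nu> \<odot>\<^bsub>Ft\<^esub> (K \<otimes>\<^bsub>Ft\<^esub> L)"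
  proof (intro allI ballI)
    fix \<mu> \<nu> K L
    assume "K \<in> half_t_graded dot I1 \<mu>" "L \<in> half_t_graded dot I1 \<nu>"
    then obtain x y where "x \<in> homogeneous \<mu>" "K = cl x" "y \<in> homogeneous \<nu>" "L = cl y"
      by (metis half_t_graded_obtain)
    then show "transported_mult K L = cov_t powi phi dot I1 \<mu> \<nu> \<odot>\<^bsub>Ft\<^esub> (K \<otimes>\<^bsub>Ft\<^esub> L)"
      by (simp add: transported_mult twist_untwist_mult half_cqg_t_mult half_cqg_t_smult cov_t_power_int)
  qed
  show "\<forall>K L. K \<notin> carrier Ft \<or> L \<notin> carrier Ft \<longrightarrow> transported_mult K L = undefined"
    by (simp add: transported_mult_def)
qed

text \<open>Both products are biadditive and agree on the classes of single terms, which are homogeneous and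
generate \<open>f[t]\<close> as a group.\<close>

lemma is_twisted_product_unique:
  assumes m: "is_twisted_product dot I1 m" and n: "is_twisted_product dot I1 n"
  shows "m = n"
proof -
  have add: "m (cl (x + y)) (cl z) = m (cl x) (cl z) \<oplus>\<^bsub>Ft\<^esub> m (cl y) (cl z)"
      "m (cl z) (cl (x + y)) = m (cl z) (cl x) \<oplus>\<^bsub>Ft\<^esub> m (cl z) (cl y)"
    if "is_twisted_product dot I1 m" for m x y z
    using that unfolding is_twisted_product_def Let_def half_cqg_t_carrier
    by (simp_all add: half_cqg_t_add[symmetric])
  have graded: "m K L = n K L" if "K \<in> half_t_graded dot I1 \<mu>" "L \<in> half_t_graded dot I1 \<nu>" for K L \<mu> \<nu>
    using m n that unfolding is_twisted_product_def Let_def by simp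
  have single: "m (cl (Poly_Mapping.single u c)) (cl y) = n (cl (Poly_Mapping.single u c)) (cl y)" for u c y
  proof (induction y rule: poly_mapping_add_induct)
    case zero
    then show ?case
      using graded[OF free_class_single_graded free_class_single_graded, of u c 0 0] by simp
  next
    case (add_single y w d)
    then show ?case
      using graded[OF free_class_single_graded free_class_single_graded]
      by (simp add: add[OF m] add[OF n])
  qed
  have eq: "m (cl x) (cl y) = n (cl x) (cl y)" for x y
  proof (induction x rule: poly_mapping_add_induct)
    case zero
    then show ?case using single[of 0 0 y] by simp
  next
    case (add_single x u c)
    then show ?case
      by (simp add: add[OF m] add[OF n] single)
  qed
  show ?thesis
  proof (intro ext)
    fix K L
    show "m K L = n K L"
    proof (cases "K \<in> carrier Ft \<and> L \<in> carrier Ft")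
      case True
      then show ?thesis using eq by (auto simp: half_cqg_t_carrier)
    next
      case False
      then show ?thesis
        using m n unfolding is_twisted_product_def Let_def by auto
    qed
  qed
qed

lemma twisted_product_eq: "twisted_product dot I1 = transported_mult"
  unfolding twisted_product_def
  by (rule the_equality[where P="is_twisted_product dot I1", OF is_twisted_product_transported])
     (rule is_twisted_product_unique[OF _ is_twisted_product_transported])

lemma class_twist_bij: "bij_betw class_twist (carrier Ft) (carrier Ft)"
  by (rule bij_betwI[where g=class_untwist])
     (auto simp: half_cqg_t_carrier class_twist class_untwist twist_untwist untwist_twist)

lemma class_twist_iso: "class_twist \<in> ring_iso Ft (half_cqg_t_twisted dot I1)"
proof (rule ring_iso_memI)
  show "bij_betw class_twist (carrier Ft) (carrier (half_cqg_t_twisted dot I1))"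
    using class_twist_bij by (simp add: half_cqg_t_twisted_def)
qed (auto simp: half_cqg_t_twisted_def half_cqg_t_carrier class_twist twisted_product_eq transported_mult
    half_cqg_t_mult half_cqg_t_add half_cqg_t_one untwist_twist twist_add twist_1)

lemma class_twist_theta: "class_twist (theta dot I1 i) = theta dot I1 i"
  by (simp add: theta_eq class_twist twist_single sig.one tpow_0)

end

theorem theorem2p4:
  fixes dot :: "'i::{finite,linorder} \<Rightarrow> 'i \<Rightarrow> int" and I1 :: "'i set"
  assumes "super_cartan_datum dot I1"
  shows "\<exists>(\<sigma> :: Qvt_pi \<Rightarrow> Qvt_pi) (\<Psi> :: 'i half_t \<Rightarrow> 'i half_t).
    \<sigma> \<in> ring_iso ring_of_type_algebra ring_of_type_algebra \<and>
    (\<forall>c. \<sigma> (cov_const c) = cov_const c) \<and>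
    \<sigma> cov_v = inverse cov_t * cov_v \<and>
    \<sigma> cov_pi = - cov_pi \<and>
    \<Psi> \<in> ring_iso (half_cqg_t dot I1) (half_cqg_t_twisted dot I1) \<and>
    (\<forall>c. \<forall>x\<in>carrier (half_cqg_t dot I1).
       \<Psi> (c \<odot>\<^bsub>half_cqg_t dot I1\<^esub> x) = \<sigma> c \<odot>\<^bsub>half_cqg_t_twisted dot I1\<^esub> \<Psi> x) \<and>
    (\<forall>i. \<Psi> (theta dot I1 i) = theta dot I1 i)"
proof (intro exI[of _ sig] exI[of _ "class_twist dot I1"] conjI allI ballI)
  have "bij sig"
    by (rule bijI'[of sig]) (auto simp: sig.injective intro: sig_sig_inv[symmetric])
  then show "sig \<in> ring_iso ring_of_type_algebra ring_of_type_algebra"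
    by (intro ring_iso_memI) (simp_all add: ring_of_type_algebra_def sig.add sig.mult sig.one)
  show "sig (cov_const c) = cov_const c" for c
    by (rule sig_const)
  show "sig cov_v = inverse cov_t * cov_v"
    by (simp add: sig_v inverse_cov_const gauss_t_nonzero)
  show "sig cov_pi = - cov_pi"
    by (rule sig_pi)
  show "class_twist dot I1 \<in> ring_iso (half_cqg_t dot I1) (half_cqg_t_twisted dot I1)"
    by (rule class_twist_iso[OF assms])
  show "class_twist dot I1 (c \<odot>\<^bsub>half_cqg_t dot I1\<^esub> x) = sig c \<odot>\<^bsub>half_cqg_t_twisted dot I1\<^esub> class_twist dot I1 x"
    if "x \<in> carrier (half_cqg_t dot I1)" for c x
    using that
    by (auto simp: half_cqg_t_twisted_def half_cqg_t_carrier class_twist[OF assms] half_cqg_t_smult twist_scalar)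
  show "class_twist dot I1 (theta dot I1 i) = theta dot I1 i" for i
    by (rule class_twist_theta[OF assms])
qed

end
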